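(* Let $X$ be a separable Banach space. (1) If $K$ is a weak$^*$-compact convex subset of $X^*$ such that $Sz(K)\le\omega^{n+1}$ for some non-negative integer $n$, then $Cz(K)=Sz(K)$. (2) $Cz(X)=Sz(X)$.
   Context: For a Banach space $X$ and a weak$^*$-compact $A\subset X^*$, the Kuratowski measure of non-compactness $\sigma(A)$ is the infimum of all $\varepsilon>0$ such that $A$ can be covered by finitely many closed balls of diameter $\varepsilon$. For $\varepsilon>0$ set $[\sigma]'_\varepsilon(A)=\{x^*\in A:\ \sigma(A\cap\overline{U}^* )\ge\varepsilon$ for every weak$^*$-neighborhood $U$ of $x^*\}$, where $\overline{U}^*$ is the weak$^*$-closure of $U$. Inductively $[\sigma]^0_\varepsilon(A)=A$, $[\sigma]^{\gamma+1}_\varepsilon(A)=[\sigma]'_\varepsilon([\sigma]^\gamma_\varepsilon(A))$, and $[\sigma]^\gamma_\varepsilon(A)=\bigcap_{\beta<\gamma}[\sigma]^\beta_\varepsilon(A)$ for $\gamma$ a limit ordinal. For a weak$^*$-compact $K\subset X^*$: $Sz(K,\varepsilon)=\inf\{\gamma:\ [\sigma]^\gamma_\varepsilon(K)=\emptyset\}$ if such an ordinal exists and $Sz(K,\varepsilon)=\infty$ otherwise; $Sz(K)=\sup_{\varepsilon>0}Sz(K,\varepsilon)$. Put $A^0_\varepsilon=K$, $A^{\beta+1}_\varepsilon=\overline{\mathrm{conv}}^*\big([\sigma]'_\varepsilon(A^\beta_\varepsilon)\big)$ (weak$^*$-closed convex hull), and $A^\beta_\varepsilon=\bigcap_{\gamma<\beta}A^\gamma_\varepsilon$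 for $\beta$ a limit ordinal. Then $Cz(K,\varepsilon)=\inf\{\beta:\ A^\beta_\varepsilon=\emptyset\}$ if such an ordinal exists and $Cz(K,\varepsilon)=\infty$ otherwise; $Cz(K)=\sup_{\varepsilon>0}Cz(K,\varepsilon)$. Finally $Sz(X)=Sz(B_{X^*})$ (Szlenk index) and $Cz(X)=Cz(B_{X^*})$ (convex Szlenk index), where $B_{X^*}$ is the closed unit ball of $X^*$. The symbol $\infty$ is regarded as larger than every ordinal. *)

theory Defs
  imports "HOL-Analysis.Analysis"
begin

section \<open>Ordinals\<close>

text \<open>
  The type \<open>'i ordinal\<close> consists of the order types of all well-orders whose field is a subset
  of \<open>'i\<close>, i.e. of all ordinals of cardinality at most that of \<open>'i\<close>.  For infinite \<open>'i\<close> this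
  initial segment of the ordinals is closed under suprema of families indexed by \<open>'i\<close>
  (lemma \<open>ordinal_bounded\<close>), hence under successors, countable suprema and ordinal arithmetic.
\<close>

quotient_type 'i ordinal = "'i rel" / partial: "\<lambda>r s :: 'i rel. (r, s) \<in> ordIso"
proof (rule part_equivpI)
  show "\<exists>x :: 'i rel. (x, x) \<in> ordIso"
    by (metis card_of_Well_order ordIso_reflexive)
  show "symp (\<lambda>r s :: 'i rel. (r, s) \<in> ordIso)"
    by (rule sympI) (rule ordIso_symmetric)
  show "transp (\<lambda>r s :: 'i rel. (r, s) \<in> ordIso)"
    by (rule transpI) (rule ordIso_transitive)
qed

lemma ordIso_self_iff: "(r, r) \<in> ordIso \<longleftrightarrow> Well_order r"
proof
  assume "(r, r) \<in> ordIso"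
  then show "Well_order r" unfolding ordIso_def by blast
qed (rule ordIso_reflexive)

lemma ordinal_cases:
  obtains r where "Well_order r" "x = abs_ordinal r"
proof
  show "Well_order (rep_ordinal x)"
    using Quotient_rep_reflp[OF Quotient_ordinal] unfolding ordIso_self_iff .
  show "x = abs_ordinal (rep_ordinal x)"
    by (rule Quotient_abs_rep[OF Quotient_ordinal, symmetric])
qed

instantiation ordinal :: (type) wellorder
begin

lift_definition less_eq_ordinal :: "'a ordinal \<Rightarrow> 'a ordinal \<Rightarrow> bool"
  is "\<lambda>r s. (r, s) \<in> ordLeq"
  by (meson ordIso_ordLeq_trans ordIso_symmetric ordLeq_ordIso_trans)

lift_definition less_ordinal :: "'a ordinal \<Rightarrow> 'a ordinal \<Rightarrow> bool"
  is "\<lambda>r s. (r, s) \<in> ordLess"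
  by (meson ordIso_ordLess_trans ordIso_symmetric ordLess_ordIso_trans)

instance
proof
  fix x y z :: "'a ordinal"
  show "x < y \<longleftrightarrow> x \<le> y \<and> \<not> y \<le> x"
    by transfer (meson not_ordLess_ordLeq ordLess_imp_ordLeq ordIso_self_iff ordLess_or_ordLeq)
  show "x \<le> x"
    by transfer (simp add: ordIso_self_iff ordLeq_reflexive)
  show "x \<le> y \<Longrightarrow> y \<le> z \<Longrightarrow> x \<le> z"
    by transfer (rule ordLeq_transitive)
  show "x \<le> y \<Longrightarrow> y \<le> x \<Longrightarrow> x = y"
    by transfer (simp add: ordIso_iff_ordLeq)
  show "x \<le> y \<or> y \<le> x"
    by transfer (simp add: ordIso_self_iff ordLeq_total)
next
  fix P :: "'a ordinal \<Rightarrow> bool" and a :: "'a ordinal"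
  assume step: "\<And>x. (\<And>y. y < x \<Longrightarrow> P y) \<Longrightarrow> P x"
  have "Well_order r \<longrightarrow> P (abs_ordinal r)" for r :: "'a rel"
    using wf_ordLess
  proof (induction r rule: wf_induct_rule)
    case (less r)
    show ?case
    proof
      assume r: "Well_order r"
      show "P (abs_ordinal r)"
      proof (rule step)
        fix y assume y: "y < abs_ordinal r"
        obtain s where s: "Well_order s" "y = abs_ordinal s"
          by (rule ordinal_cases)
        with y r have "(s, r) \<in> ordLess"
          by (simp add: less_ordinal.abs_eq ordIso_reflexive)
        with less s show "P y" by simp
      qed
    qed
  qed
  moreover obtain r where "Well_order r" "a = abs_ordinal r"
    by (rule ordinal_cases)
  ultimately show "P a" by simp
qed

end

lemma ordinal_initial_segment:
  fixes s :: "'i rel"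
  assumes s: "Well_order s"
  defines "h \<equiv> \<lambda>b. abs_ordinal (Restr s (underS s b))"
  shows "bij_betw h (Field s) {..<abs_ordinal s}"
    and "\<And>a b. a \<in> Field s \<Longrightarrow> b \<in> Field s \<Longrightarrow> h a \<le> h b \<longleftrightarrow> (a, b) \<in> s"
proof -
  interpret s: wo_rel s by (simp add: wo_rel_def s)
  have W: "Well_order (Restr s (underS s b))" for b
    by (simp add: Well_order_Restr s)
  have less: "h a < h b" if "a \<in> Field s" "b \<in> Field s" "(a, b) \<in> s" "a \<noteq> b" for a b
  proof -
    have "underS s a \<subset> underS s b"
      using that s.ANTISYM s.TRANS unfolding underS_def antisym_def trans_def by blast
    then have "(Restr s (underS s a), Restr s (underS s b)) \<in> ordLess"
      using ofilter_subset_ordLess[OF s] s.underS_ofilter by blast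
    then show ?thesis
      by (simp add: h_def less_ordinal.abs_eq W ordIso_reflexive)
  qed
  show iff: "h a \<le> h b \<longleftrightarrow> (a, b) \<in> s" if "a \<in> Field s" "b \<in> Field s" for a b
    using that less[of a b] less[of b a] s.TOTALS s.REFL
    by (metis leD less_imp_le order_refl refl_onD)
  show "bij_betw h (Field s) {..<abs_ordinal s}"
    unfolding bij_betw_def
  proof (intro conjI subset_antisym subsetI)
    show "inj_on h (Field s)"
      by (rule inj_onI) (metis iff order_refl s.ANTISYM antisymD)
    fix x
    { assume "x \<in> h ` Field s"
      then show "x \<in> {..<abs_ordinal s}"
        by (auto simp: h_def less_ordinal.abs_eq W s ordIso_reflexive intro!: underS_Restr_ordLess) }
    { assume x: "x \<in> {..<abs_ordinal s}"
      obtain r where r: "Well_order r" "x = abs_ordinal r"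
        by (rule ordinal_cases)
      with x have "(r, s) \<in> ordLess" by (simp add: less_ordinal.abs_eq s ordIso_reflexive)
      then obtain b where "b \<in> Field s" "(r, Restr s (underS s b)) \<in> ordIso"
        using ordLess_iff_ordIso_Restr[OF s r(1)] by blast
      then show "x \<in> h ` Field s"
        using r(2) Quotient_rel_abs[OF Quotient_ordinal] unfolding h_def by blast }
  qed
qed


lemma card_initial_segment:
  fixes x :: "'i ordinal"
  shows "(card_of {..<x}, card_of (UNIV :: 'i set)) \<in> ordLeq"
proof -
  obtain s where s: "Well_order s" "x = abs_ordinal s"
    by (rule ordinal_cases)
  from ordinal_initial_segment(1)[OF s(1)] obtain h where "bij_betw h (Field s) {..<x}"
    unfolding s(2) by blast
  then have "bij_betw (inv_into (Field s) h) {..<x} (Field s)"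
    by (rule bij_betw_inv_into)
  then show ?thesis
    by (meson bij_betw_imp_inj_on card_of_ordLeqI UNIV_I)
qed

lemma no_inj_ordinal: "\<not> inj (f :: 'i ordinal \<Rightarrow> 'i)"
proof
  assume inj: "inj f"
  define r where "r = {(f x, f y) | x y. x \<le> y}"
  have Field: "Field r = range f"
    unfolding r_def Field_def by auto
  have r_iff: "(f x, f y) \<in> r \<longleftrightarrow> x \<le> y" for x y
    using inj unfolding r_def inj_def by auto
  have "Well_order r"
    unfolding well_order_on_def linear_order_on_def partial_order_on_def preorder_on_def
  proof (intro conjI)
    show "refl_on (Field r) r" "total_on (Field r) r"
      unfolding Field by (auto simp: refl_on_def total_on_def r_iff)
    show "r \<subseteq> Field r \<times> Field r"
      by (auto intro: FieldI1 FieldI2)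
    show "trans r"
    proof (rule transI)
      fix a b c assume ab: "(a, b) \<in> r" and bc: "(b, c) \<in> r"
      then obtain x y z where "a = f x" "b = f y" "c = f z"
        unfolding r_def by blast
      with ab bc show "(a, c) \<in> r"
        by (auto simp: r_iff intro: order_trans)
    qed
    show "antisym r"
    proof (rule antisymI)
      fix a b assume ab: "(a, b) \<in> r" "(b, a) \<in> r"
      then obtain x y where "a = f x" "b = f y"
        unfolding r_def by blast
      with ab show "a = b"
        by (auto simp: r_iff)
    qed
    have "r - Id \<subseteq> inv_image {(x, y). x < y} (inv f)"
    proof (rule subrelI)
      fix a b assume ab: "(a, b) \<in> r - Id"
      then obtain x y where "a = f x" "b = f y" "x \<le> y"
        unfolding r_def by blast
      with ab inj show "(a, b) \<in> inv_image {(x, y). x < y} (inv f)"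
        by (auto simp: less_le)
    qed
    then show "wf (r - Id)"
      by (rule wf_subset[OF wf_inv_image[OF wf]])
  qed
  define h where "h b = abs_ordinal (Restr r (underS r b))" for b
  note h = ordinal_initial_segment[OF \<open>Well_order r\<close>, folded h_def]
  have mono: "h (f x) \<le> h (f y) \<longleftrightarrow> x \<le> y" for x y
    using h(2) by (simp add: Field r_iff)
  have "x \<le> h (f x)" for x
  proof (induction x rule: less_induct)
    case (less x)
    show ?case
    proof (rule ccontr)
      assume "\<not> x \<le> h (f x)"
      then have "h (f x) < x" by simp
      with less have "h (f x) \<le> h (f (h (f x)))" by simp
      with mono \<open>h (f x) < x\<close> show False by (meson leD)
    qed
  qed
  moreover have "h (f (abs_ordinal r)) < abs_ordinal r"
    using h(1) Field by (auto simp: bij_betw_def)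
  ultimately show False
    by (meson leD)
qed

lemma ordinal_bounded:
  fixes S :: "'i ordinal set"
  assumes inf: "infinite (UNIV :: 'i set)" and S: "(card_of S, card_of (UNIV :: 'i set)) \<in> ordLeq"
  shows "\<exists>b. \<forall>x\<in>S. x < b"
proof (rule ccontr)
  assume *: "\<nexists>b. \<forall>x\<in>S. x < b"
  then have "\<exists>x\<in>S. y \<le> x" for y
    by (meson not_le)
  then have 1: "(\<Union>x\<in>S. {..<x}) \<union> S = (UNIV :: 'i ordinal set)"
    by (force simp: le_less)
  let ?r = "card_of (UNIV :: 'i set)"
  have "(card_of (\<Union>x\<in>S. {..<x}), ?r) \<in> ordLeq"
    by (rule card_of_UNION_ordLeq_infinite[OF inf S]) (intro ballI card_initial_segment)
  moreover have "infinite (Field ?r)"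
    using inf by (simp only: Field_card_of not_False_eq_True)
  ultimately have "(card_of ((\<Union>x\<in>S. {..<x}) \<union> S), ?r) \<in> ordLeq"
    using S card_of_Card_order by (intro card_of_Un_ordLeq_infinite_Field)
  then obtain f :: "'i ordinal \<Rightarrow> 'i" where "inj f"
    unfolding 1 card_of_ordLeq[symmetric] by (elim exE conjE)
  then show False
    using no_inj_ordinal by (rule notE[rotated])
qed

text \<open>
  Addition and multiplication by the usual transfinite recursion on the second argument, with the
  cases zero, successor and limit merged into one: \<open>a + b\<close> is the supremum of \<open>a\<close> and of all
  \<open>(a + c) + 1\<close> with \<open>c < b\<close>, and \<open>a * b\<close> is the supremum of all \<open>a * c + a\<close> with \<open>c < b\<close>.
\<close>

function ord_plus :: "'o :: wellorder \<Rightarrow> 'o \<Rightarrow> 'o" where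
  "ord_plus a b = (LEAST d. a \<le> d \<and> (\<forall>x\<in>(\<lambda>c. ord_plus a c) ` {..<b}. x < d))"
  by pat_completeness auto
termination
  by (relation "inv_image {(x, y). x < y} snd") (auto intro!: wf_inv_image wf)

declare ord_plus.simps [simp del]

function ord_times :: "'o :: wellorder \<Rightarrow> 'o \<Rightarrow> 'o" where
  "ord_times a b = (LEAST d. \<forall>x\<in>(\<lambda>c. ord_times a c) ` {..<b}. ord_plus x a \<le> d)"
  by pat_completeness auto
termination
  by (relation "inv_image {(x, y). x < y} snd") (auto intro!: wf_inv_image wf)

declare ord_times.simps [simp del]

instantiation ordinal :: (type) "{zero, one, plus, times}"
begin

definition zero_ordinal :: "'a ordinal" where "(0 :: 'a ordinal) = (LEAST a. True)"

definition one_ordinal :: "'a ordinal" where "(1 :: 'a ordinal) = (LEAST a. 0 < a)"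

definition plus_ordinal :: "'a ordinal \<Rightarrow> 'a ordinal \<Rightarrow> 'a ordinal" where
  "plus_ordinal = ord_plus"

definition times_ordinal :: "'a ordinal \<Rightarrow> 'a ordinal \<Rightarrow> 'a ordinal" where
  "times_ordinal = ord_times"

instance ..

end

instance ordinal :: (type) power ..

definition succ :: "'o :: wellorder \<Rightarrow> 'o" where
  "succ a = (LEAST b. a < b)"

definition is_limit :: "'o :: wellorder \<Rightarrow> bool" where
  "is_limit a \<longleftrightarrow> (\<exists>b. b < a) \<and> (\<forall>b<a. \<exists>c<a. b < c)"

definition omega :: "'i ordinal" where
  "omega = (LEAST a. is_limit a)"

lemma zero_ordinal_least [simp]: "(0 :: 'i ordinal) \<le> a"
  unfolding zero_ordinal_def by (rule Least_le) simp

lemma less_succ_iff: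
  fixes a c :: "'i ordinal"
  assumes "infinite (UNIV :: 'i set)"
  shows "c < succ a \<longleftrightarrow> c \<le> a"
proof -
  have "(card_of {a}, card_of (UNIV :: 'i set)) \<in> ordLeq"
    by (rule card_of_ordLeqI[of "\<lambda>_. undefined"]) auto
  then have "\<exists>b. a < b"
    using ordinal_bounded[OF assms, of "{a}"] by auto
  then have "a < succ a"
    unfolding succ_def by (rule LeastI_ex)
  moreover have "succ a \<le> b" if "a < b" for b
    unfolding succ_def using that by (rule Least_le)
  ultimately show ?thesis
    by (meson leD le_less_trans not_le)
qed

lemma is_limit_omega:
  assumes inf: "infinite (UNIV :: 'i set)"
  shows "is_limit (omega :: 'i ordinal)"
proof -
  define S where "S = range (\<lambda>n. (succ ^^ n) (0 :: 'i ordinal))"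
  have "(card_of S, card_of (UNIV :: nat set)) \<in> ordLeq"
    unfolding S_def by (rule card_of_image)
  moreover have "(card_of (UNIV :: nat set), card_of (UNIV :: 'i set)) \<in> ordLeq"
    using inf by (rule infinite_iff_card_of_nat[THEN iffD1])
  ultimately have "\<exists>b. \<forall>x\<in>S. x < b"
    by (intro ordinal_bounded[OF inf]) (rule ordLeq_transitive)
  then have ub: "\<forall>x\<in>S. x < (LEAST b. \<forall>x\<in>S. x < b)" (is "\<forall>x\<in>S. x < ?b")
    by (rule LeastI_ex)
  have succ: "succ x \<in> S" if "x \<in> S" for x
  proof -
    from that obtain n where "x = (succ ^^ n) 0"
      unfolding S_def by blast
    then have "succ x = (succ ^^ Suc n) 0" by simp
    then show ?thesis
      unfolding S_def by (rule range_eqI)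
  qed
  have "is_limit ?b"
    unfolding is_limit_def
  proof (intro conjI allI impI)
    have "0 \<in> S"
      unfolding S_def by (rule range_eqI[of _ _ 0]) simp
    with ub show "\<exists>c. c < ?b" by blast
    fix c assume "c < ?b"
    then have "\<not> (\<forall>x\<in>S. x < c)"
      by (rule not_less_Least)
    then obtain x where x: "x \<in> S" "c \<le> x"
      by (auto simp: not_less)
    then have "succ x < ?b" "c < succ x"
      using ub succ by (simp_all add: less_succ_iff[OF inf])
    then show "\<exists>d<?b. c < d" by blast
  qed
  then show ?thesis
    unfolding omega_def by (rule LeastI)
qed

lemma ordinal_bounded_image:
  fixes f :: "'i ordinal \<Rightarrow> 'i ordinal"
  assumes "infinite (UNIV :: 'i set)"
  shows "\<exists>d. \<forall>c<b. f c < d"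
proof -
  have "(card_of (f ` {..<b}), card_of (UNIV :: 'i set)) \<in> ordLeq"
    using card_of_image card_initial_segment ordLeq_transitive by blast
  from ordinal_bounded[OF assms this] show ?thesis
    by auto
qed

lemma plus_ordinal_le_iff:
  fixes a b d :: "'i ordinal"
  assumes "infinite (UNIV :: 'i set)"
  shows "a + b \<le> d \<longleftrightarrow> a \<le> d \<and> (\<forall>c<b. a + c < d)"
proof -
  let ?P = "\<lambda>d. a \<le> d \<and> (\<forall>c\<in>{..<b}. a + c < d)"
  obtain e where "\<forall>c<b. a + c < e"
    using ordinal_bounded_image[OF assms, of b "\<lambda>c. a + c"] by blast
  then have "?P (max a e)"
    by (auto simp: less_max_iff_disj)
  then have "?P (LEAST d. ?P d)"
    by (rule LeastI)
  moreover have eq: "a + b = (LEAST d. ?P d)"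
    unfolding plus_ordinal_def by (subst ord_plus.simps) simp
  ultimately have "?P (a + b)" by simp
  moreover have "a + b \<le> d" if "?P d" for d
    unfolding eq using that by (rule Least_le)
  ultimately show ?thesis
    unfolding Ball_def lessThan_iff by (blast intro: order_trans order_less_le_trans)
qed

lemma times_ordinal_le_iff:
  fixes a b d :: "'i ordinal"
  assumes "infinite (UNIV :: 'i set)"
  shows "a * b \<le> d \<longleftrightarrow> (\<forall>c<b. a * c + a \<le> d)"
proof -
  let ?P = "\<lambda>d. \<forall>c\<in>{..<b}. a * c + a \<le> d"
  obtain e where "\<forall>c<b. a * c + a < e"
    using ordinal_bounded_image[OF assms, of b "\<lambda>c. a * c + a"] by blast
  then have "?P e"
    by (simp add: less_imp_le)
  then have "?P (LEAST d. ?P d)"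
    by (rule LeastI)
  moreover have eq: "a * b = (LEAST d. ?P d)"
    unfolding times_ordinal_def plus_ordinal_def by (subst ord_times.simps) simp
  ultimately have "?P (a * b)" by simp
  moreover have "a * b \<le> d" if "?P d" for d
    unfolding eq using that by (rule Least_le)
  ultimately show ?thesis
    unfolding Ball_def lessThan_iff by (blast intro: order_trans)
qed

lemma less_plus_ordinal:
  fixes a b c :: "'i ordinal"
  assumes "infinite (UNIV :: 'i set)" "c < b"
  shows "a + c < a + b"
  using plus_ordinal_le_iff[OF assms(1), of a b "a + b"] assms(2) by blast

lemma ordinal_arithmetic:
  fixes a b :: "'i ordinal"
  assumes inf: "infinite (UNIV :: 'i set)"
  shows "a + 0 = a"
    and "a + succ b = succ (a + b)"
    and "a * 0 = 0"
    and "a * succ b = a * b + a"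
    and "1 = succ (0 :: 'i ordinal)"
proof -
  have not_less_0: "\<not> c < 0" for c :: "'i ordinal"
    by (simp add: not_less)
  have mono: "a + c \<le> a + b" if "c \<le> b" for c
    using that less_plus_ordinal[OF inf, of c b a] by (auto simp: le_less)
  have mono': "a * c + a \<le> a * b + a" if "c \<le> b" for c
  proof -
    have le: "a * c \<le> a * b"
      unfolding times_ordinal_le_iff[OF inf, of a c]
      using times_ordinal_le_iff[OF inf, of a b "a * b"] that
      by (blast intro: order_less_le_trans)
    have "x + y \<le> x' + y" if "x \<le> x'" for x x' y :: "'i ordinal"
    proof (induction y rule: less_induct)
      case (less y)
      have "x \<le> x' + y"
        using that plus_ordinal_le_iff[OF inf, of x' y "x' + y"] by auto
      moreover have "x + c < x' + y" if "c < y" for c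
        using less[OF that] less_plus_ordinal[OF inf that, of x'] by simp
      ultimately show ?case
        by (simp add: plus_ordinal_le_iff[OF inf])
    qed
    with le show ?thesis by blast
  qed
  have succ_le: "succ x \<le> d \<longleftrightarrow> x < d" for x d :: "'i ordinal"
    using less_succ_iff[OF inf] by (meson not_le)
  have eqI: "x = y" if "\<And>d. x \<le> d \<longleftrightarrow> y \<le> d" for x y :: "'i ordinal"
    using that by (meson antisym order_refl)
  show "a + 0 = a"
    by (rule eqI) (simp add: plus_ordinal_le_iff[OF inf] not_less_0)
  show "a * 0 = 0"
    by (rule eqI) (simp add: times_ordinal_le_iff[OF inf] not_less_0)
  show "a + succ b = succ (a + b)"
  proof (rule eqI)
    fix d
    have "a + succ b \<le> d \<longleftrightarrow> a \<le> d \<and> (\<forall>c\<le>b. a + c < d)"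
      by (simp add: plus_ordinal_le_iff[OF inf, of a "succ b"] less_succ_iff[OF inf])
    also have "\<dots> \<longleftrightarrow> a + b < d"
    proof
      assume "a + b < d"
      moreover have "a \<le> a + b"
        using plus_ordinal_le_iff[OF inf, of a b "a + b"] by simp
      ultimately show "a \<le> d \<and> (\<forall>c\<le>b. a + c < d)"
        using mono by (meson le_less_trans less_imp_le)
    qed simp
    finally show "a + succ b \<le> d \<longleftrightarrow> succ (a + b) \<le> d"
      by (simp add: succ_le)
  qed
  show "a * succ b = a * b + a"
  proof (rule eqI)
    fix d
    have "a * succ b \<le> d \<longleftrightarrow> (\<forall>c\<le>b. a * c + a \<le> d)"
      by (simp add: times_ordinal_le_iff[OF inf, of a "succ b"] less_succ_iff[OF inf])
    also have "\<dots> \<longleftrightarrow> a * b + a \<le> d"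
      using mono' by (meson order_refl order_trans)
    finally show "a * succ b \<le> d \<longleftrightarrow> a * b + a \<le> d" .
  qed
  show "1 = succ (0 :: 'i ordinal)"
    by (simp add: one_ordinal_def succ_def)
qed

section \<open>Transfinite iteration\<close>

lemma Greatest_less:
  fixes a b :: "'o :: wellorder"
  assumes "b < a" "\<not> is_limit a"
  shows "(GREATEST b. b < a) < a"
proof -
  obtain c where "c < a" "\<And>d. d < a \<Longrightarrow> d \<le> c"
    using assms unfolding is_limit_def by (meson not_less)
  then show ?thesis
    by (metis Greatest_equality)
qed

function trans_iter :: "('s set \<Rightarrow> 's set) \<Rightarrow> 's set \<Rightarrow> 'o :: wellorder \<Rightarrow> 's set" where
  "trans_iter D K a =
     (if \<forall>b. a \<le> b then K
      else if is_limit a then \<Inter>b\<in>{..<a}. trans_iter D K b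
      else D (trans_iter D K (GREATEST b. b < a)))"
  by pat_completeness auto
termination
  by (relation "inv_image {(x, y). x < y} (\<lambda>(_, _, a). a)")
    (auto intro!: wf_inv_image wf simp: not_le intro: Greatest_less)

declare trans_iter.simps [simp del]

lemma trans_iter_zero: "trans_iter D K (0 :: 'i ordinal) = K"
  by (subst trans_iter.simps) simp

lemma trans_iter_succ:
  assumes "infinite (UNIV :: 'i set)"
  shows "trans_iter D K (succ a) = D (trans_iter D K (a :: 'i ordinal))"
proof -
  have "a < succ a"
    by (simp add: less_succ_iff[OF assms])
  moreover have "(GREATEST b. b < succ a) = a"
    by (rule Greatest_equality) (simp_all add: less_succ_iff[OF assms])
  moreover have "\<not> is_limit (succ a)"
    unfolding is_limit_def using less_succ_iff[OF assms] by (meson leD order_refl)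
  ultimately show ?thesis
    by (subst trans_iter.simps) (auto simp: not_le dest: leD)
qed

lemma trans_iter_limit:
  assumes "is_limit a"
  shows "trans_iter D K a = (\<Inter>b\<in>{..<a}. trans_iter D K b)"
proof -
  obtain b where "b < a"
    using assms by (auto simp: is_limit_def)
  then have "\<not> (\<forall>b. a \<le> b)"
    by (meson leD)
  with assms show ?thesis
    by (subst trans_iter.simps) argo
qed

lemma trans_iter_antimono:
  fixes a b :: "'o :: wellorder"
  assumes D: "\<And>c :: 'o. D (trans_iter D K c) \<subseteq> trans_iter D K c" and "a \<le> b"
  shows "trans_iter D K b \<subseteq> trans_iter D K a"
  using \<open>a \<le> b\<close>
proof (induction b rule: less_induct)
  case (less b)
  show ?case
  proof (cases "a = b")
    case False
    with less have ab: "a < b" by simp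
    show ?thesis
    proof (cases "is_limit b")
      case True
      with ab show ?thesis by (auto simp: trans_iter_limit)
    next
      case nl: False
      with ab obtain c where c: "c < b" "\<forall>d<b. d \<le> c"
        unfolding is_limit_def by (meson not_less)
      then have "(GREATEST d. d < b) = c"
        by (intro Greatest_equality) auto
      with nl ab have "trans_iter D K b = D (trans_iter D K c)"
        by (subst trans_iter.simps) (auto simp: not_le dest: leD)
      then show ?thesis
        using D[of c] less.IH[of c] c ab by auto
    qed
  qed simp
qed

lemma trans_iter_stationary:
  fixes D :: "'s set \<Rightarrow> 's set"
  assumes D: "\<And>a :: ('s + nat) ordinal. D (trans_iter D K a) \<subseteq> trans_iter D K a"
  shows "\<exists>a :: ('s + nat) ordinal. D (trans_iter D K a) = trans_iter D K a"
proof (rule ccontr)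
  have inf: "infinite (UNIV :: ('s + nat) set)"
    by simp
  assume "\<nexists>a :: ('s + nat) ordinal. D (trans_iter D K a) = trans_iter D K a"
  with D have "\<exists>x. x \<in> trans_iter D K a - D (trans_iter D K a)" for a :: "('s + nat) ordinal"
    by blast
  then obtain f where f: "f a \<in> trans_iter D K a - D (trans_iter D K a)" for a :: "('s + nat) ordinal"
    by metis
  have "f a \<noteq> f b" if "a < b" for a b
  proof -
    have "succ a \<le> b"
      using that less_succ_iff[OF inf] by (meson not_le)
    with D have "trans_iter D K b \<subseteq> trans_iter D K (succ a)"
      by (rule trans_iter_antimono)
    with f[of b] have "f b \<in> D (trans_iter D K a)"
      unfolding trans_iter_succ[OF inf] by (elim DiffE) (rule subsetD)
    with f[of a] show ?thesis by (elim DiffE) metis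
  qed
  then have "inj (\<lambda>a. Inl (f a) :: 's + nat)"
    by (intro injI) (metis sum.inject(1) linorder_neqE)
  then show False
    using no_inj_ordinal by blast
qed

section \<open>Ordinals together with infinity\<close>

datatype 'o with_infty = Ord 'o | Infty

instantiation with_infty :: (wellorder) complete_linorder
begin

fun less_eq_with_infty :: "'a with_infty \<Rightarrow> 'a with_infty \<Rightarrow> bool" where
  "less_eq_with_infty x Infty = True"
| "less_eq_with_infty Infty (Ord b) = False"
| "less_eq_with_infty (Ord a) (Ord b) = (a \<le> b)"

definition less_with_infty :: "'a with_infty \<Rightarrow> 'a with_infty \<Rightarrow> bool" where
  "less_with_infty x y \<longleftrightarrow> x \<le> y \<and> \<not> y \<le> x"

definition inf_with_infty :: "'a with_infty \<Rightarrow> 'a with_infty \<Rightarrow> 'a with_infty" where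
  "inf_with_infty x y = (if x \<le> y then x else y)"

definition sup_with_infty :: "'a with_infty \<Rightarrow> 'a with_infty \<Rightarrow> 'a with_infty" where
  "sup_with_infty x y = (if x \<le> y then y else x)"

definition Inf_with_infty :: "'a with_infty set \<Rightarrow> 'a with_infty" where
  "Inf_with_infty S = (if \<exists>a. Ord a \<in> S then Ord (LEAST a. Ord a \<in> S) else Infty)"

definition Sup_with_infty :: "'a with_infty set \<Rightarrow> 'a with_infty" where
  "Sup_with_infty S = Inf {u. \<forall>x\<in>S. x \<le> u}"

definition top_with_infty :: "'a with_infty" where
  "top_with_infty = Infty"

definition bot_with_infty :: "'a with_infty" where
  "bot_with_infty = Ord (LEAST a. True)"

instance
proof -
  have refl: "x \<le> x" for x :: "'a with_infty"
    by (cases x) auto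
  have trans: "x \<le> y \<Longrightarrow> y \<le> z \<Longrightarrow> x \<le> z" for x y z :: "'a with_infty"
    by (cases x; cases y; cases z) auto
  have antisym: "x \<le> y \<Longrightarrow> y \<le> x \<Longrightarrow> x = y" for x y :: "'a with_infty"
    by (cases x; cases y) auto
  have total: "x \<le> y \<or> y \<le> x" for x y :: "'a with_infty"
    by (cases x; cases y) auto
  have Inf_lower: "x \<in> S \<Longrightarrow> Inf S \<le> x" for x :: "'a with_infty" and S
    unfolding Inf_with_infty_def by (cases x) (auto intro: Least_le)
  have Inf_greatest: "(\<And>x. x \<in> S \<Longrightarrow> z \<le> x) \<Longrightarrow> z \<le> Inf S" for z :: "'a with_infty" and S
  proof (cases "\<exists>a. Ord a \<in> S")
    case True
    then have "Ord (LEAST a. Ord a \<in> S) \<in> S"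
      by (rule LeastI_ex)
    with True show "(\<And>x. x \<in> S \<Longrightarrow> z \<le> x) \<Longrightarrow> z \<le> Inf S"
      by (simp add: Inf_with_infty_def)
  qed (simp add: Inf_with_infty_def)
  show "OFCLASS('a with_infty, complete_linorder_class)"
  proof
    fix x y z :: "'a with_infty" and S :: "'a with_infty set"
    show "x \<in> S \<Longrightarrow> x \<le> Sup S"
      unfolding Sup_with_infty_def by (rule Inf_greatest) simp
    show "(\<And>x. x \<in> S \<Longrightarrow> x \<le> z) \<Longrightarrow> Sup S \<le> z"
      unfolding Sup_with_infty_def by (rule Inf_lower) simp
    show "Inf {} = (top :: 'a with_infty)"
      by (simp add: Inf_with_infty_def top_with_infty_def)
    show "Sup {} = (bot :: 'a with_infty)"
      by (auto simp: Sup_with_infty_def Inf_with_infty_def bot_with_infty_def)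
    show "x < y \<longleftrightarrow> x \<le> y \<and> \<not> y \<le> x"
      by (rule less_with_infty_def)
    show "inf x y \<le> x" "inf x y \<le> y" "x \<le> y \<Longrightarrow> x \<le> z \<Longrightarrow> x \<le> inf y z"
      using total[of x y] refl by (auto simp: inf_with_infty_def)
    show "x \<le> sup x y" "y \<le> sup x y" "y \<le> x \<Longrightarrow> z \<le> x \<Longrightarrow> sup y z \<le> x"
      using total[of x y] refl by (auto simp: sup_with_infty_def)
  qed (fact refl trans antisym total Inf_lower Inf_greatest)+
qed

end

section \<open>The Szlenk index and the convex Szlenk index\<close>

type_synonym 'a dual = "'a \<Rightarrow>\<^sub>L real"

text \<open>
  \<open>strong_operator_topology\<close> is the topology of pointwise convergence on the bounded linear maps;
  for real-valued maps this is the weak-star topology.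
\<close>

abbreviation weak_star :: "'a :: real_normed_vector dual topology" where
  "weak_star \<equiv> strong_operator_topology"

text \<open>A closed ball of diameter \<open>\<epsilon>\<close> is a closed ball of radius \<open>\<epsilon> / 2\<close> for the dual norm.\<close>

definition kuratowski :: "'a :: real_normed_vector dual set \<Rightarrow> ereal" where
  "kuratowski A =
     Inf {ereal \<epsilon> | \<epsilon>. \<epsilon> > 0 \<and> (\<exists>C. finite C \<and> A \<subseteq> (\<Union>c\<in>C. cball c (\<epsilon> / 2)))}"

definition weak_star_nhd :: "'a :: real_normed_vector dual \<Rightarrow> 'a dual set \<Rightarrow> bool" where
  "weak_star_nhd x U \<longleftrightarrow> (\<exists>V. openin weak_star V \<and> x \<in> V \<and> V \<subseteq> U)"

definition sigma_deriv :: "real \<Rightarrow> 'a :: real_normed_vector dual set \<Rightarrow> 'a dual set" where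
  "sigma_deriv \<epsilon> A =
     {x \<in> A. \<forall>U. weak_star_nhd x U \<longrightarrow> kuratowski (A \<inter> weak_star closure_of U) \<ge> ereal \<epsilon>}"

definition convex_sigma_deriv :: "real \<Rightarrow> 'a :: real_normed_vector dual set \<Rightarrow> 'a dual set" where
  "convex_sigma_deriv \<epsilon> A = weak_star closure_of (convex hull (sigma_deriv \<epsilon> A))"

text \<open>
  The ordinals of cardinality at most \<open>max(|X*|, \<omega>)\<close>.  They suffice to index the derivations of
  subsets of \<open>X*\<close>: a decreasing iteration becomes stationary at one of them
  (lemma \<open>trans_iter_stationary\<close>), and \<open>Sz_eps K \<epsilon>\<close> and \<open>Cz_eps K \<epsilon>\<close> grow as \<open>\<epsilon>\<close> decreases,
  so that the suprema over \<open>\<epsilon>\<close> below are countable.  Hence none of the indices is infinite merely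
  because the type of ordinals is too small.
\<close>

type_synonym 'a index_ordinal = "('a dual + nat) ordinal"

definition Sz_eps :: "'a :: real_normed_vector dual set \<Rightarrow> real \<Rightarrow> 'a index_ordinal with_infty" where
  "Sz_eps K \<epsilon> = Inf {Ord \<gamma> | \<gamma>. trans_iter (sigma_deriv \<epsilon>) K \<gamma> = {}}"

definition Sz :: "'a :: real_normed_vector dual set \<Rightarrow> 'a index_ordinal with_infty" where
  "Sz K = (SUP \<epsilon>\<in>{0<..}. Sz_eps K \<epsilon>)"

definition Cz_eps :: "'a :: real_normed_vector dual set \<Rightarrow> real \<Rightarrow> 'a index_ordinal with_infty" where
  "Cz_eps K \<epsilon> = Inf {Ord \<beta> | \<beta>. trans_iter (convex_sigma_deriv \<epsilon>) K \<beta> = {}}"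

definition Cz :: "'a :: real_normed_vector dual set \<Rightarrow> 'a index_ordinal with_infty" where
  "Cz K = (SUP \<epsilon>\<in>{0<..}. Cz_eps K \<epsilon>)"

definition Szlenk_index :: "'a :: banach itself \<Rightarrow> 'a index_ordinal with_infty" where
  "Szlenk_index _ = Sz (cball 0 1 :: 'a dual set)"

definition convex_Szlenk_index :: "'a :: banach itself \<Rightarrow> 'a index_ordinal with_infty" where
  "convex_Szlenk_index _ = Cz (cball 0 1 :: 'a dual set)"

end

theory Submission
  imports Defs
begin

text \<open>
  Both parts are instances of \<open>Cz K = Sz K\<close> for a weak-star compact convex set \<open>K\<close>. The inequality
  \<open>Sz K \<le> Cz K\<close> is monotonicity. If \<open>z\<close> survives \<open>a\<close> derivations at scale \<open>\<epsilon>\<close>, then \<open>(K + z) / 2\<close>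
  survives \<open>a\<close> derivations at scale \<open>\<epsilon> / 2\<close>; hence \<open>Sz K\<close> is additively indecomposable, and it is
  enough to show that for indecomposable \<open>g\<close> and \<open>\<epsilon> < \<epsilon>'\<close>, if \<open>g\<close> derivations at scale \<open>\<epsilon>\<close> empty \<open>K\<close>,
  then so do \<open>g\<close> convex derivations at scale \<open>\<epsilon>'\<close>.

  This goes by induction on \<open>g\<close>. By compactness some \<open>d * N\<close> derivations suffice, with \<open>d < g\<close>
  indecomposable and \<open>N\<close> finite. Let \<open>f\<close> be minus the number of blocks of \<open>d\<close> derivations that a point
  survives; it is lower semicontinuous. Let \<open>f'\<close> be its convex hull and let \<open>h < f'\<close> be affine. For
  every \<open>y\<close> with \<open>f' y\<close> close to \<open>h y\<close>, optimal convex representations of \<open>y\<close> for the cost \<open>f\<close> are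
  concentrated, by Markov's inequality, on the set where \<open>f - h\<close> is small. That set is a finite union of
  closed sets, each contained in one block and disjoint from the next, so \<open>d\<close> derivations empty it,
  and by induction \<open>d\<close> convex derivations push a sublevel set of \<open>f'\<close> below \<open>h\<close>. As \<open>f\<close> is
  bounded, finitely many such steps are enough.

  Convex derivations do not localise to slices, so the induction hypothesis must speak about slices of
  a larger set. The cost of the previous stage is therefore kept and perturbed by a small multiple of \<open>f\<close>
  and a large multiple of the functional that defines the slice.
\<close>

subsection \<open>Transfinite iteration\<close>

lemma inf_sum: "infinite (UNIV :: ('s + nat) set)"
  by simp

lemma eq_succI:
  fixes a b :: "('s + nat) ordinal"
  assumes "b < a" "\<And>c. c < a \<Longrightarrow> c \<le> b"
  shows "a = succ b"
proof (rule antisym)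
  show "a \<le> succ b"
    using assms(2)[of "succ b"] less_succ_iff[OF inf_sum, of b b] by (meson leD not_le order_refl)
  show "succ b \<le> a"
    using assms(1) less_succ_iff[OF inf_sum, of a b] by (meson leD not_le)
qed

lemma ordinal_induct [case_names zero succ limit]:
  fixes a :: "('s + nat) ordinal"
  assumes zero: "P 0"
    and succ: "\<And>a. P a \<Longrightarrow> P (succ a)"
    and limit: "\<And>a. is_limit a \<Longrightarrow> (\<And>b. b < a \<Longrightarrow> P b) \<Longrightarrow> P a"
  shows "P a"
proof (induction a rule: less_induct)
  case (less a)
  show ?case
  proof (cases "is_limit a")
    case True
    with less show ?thesis by (rule limit[rotated])
  next
    case False
    show ?thesis
    proof (cases "a = 0")
      case False
      then have "0 < a"
        using zero_ordinal_least[of a] by (simp add: le_less)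
      with \<open>\<not> is_limit a\<close> obtain b where b: "b < a" "\<And>c. c < a \<Longrightarrow> c \<le> b"
        unfolding is_limit_def by (meson not_less)
      have "a = succ b"
        using b by (rule eq_succI)
      with less b show ?thesis by (auto intro: succ)
    qed (simp add: zero)
  qed
qed

section \<open>Ordinal addition and composition of iterations\<close>

lemma plus_mono_right:
  fixes a b c :: "('s + nat) ordinal"
  assumes "b \<le> c"
  shows "a + b \<le> a + c"
  using assms less_plus_ordinal[of b c a] by (auto simp: le_less)

lemma le_plus_left:
  fixes a b :: "('s + nat) ordinal"
  shows "a \<le> a + b"
  using plus_ordinal_le_iff[of a b "a + b"] by simp

lemma is_limit_plus:
  fixes a b :: "('s + nat) ordinal"
  assumes "is_limit b"
  shows "is_limit (a + b)"
  unfolding is_limit_def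
proof (intro conjI allI impI)
  obtain c where "c < b"
    using assms by (auto simp: is_limit_def)
  then show "\<exists>d. d < a + b"
    using less_plus_ordinal[OF inf_sum] by blast
  fix d assume d: "d < a + b"
  then have "\<not> a + b \<le> d" by simp
  then have "d < a \<or> (\<exists>c<b. d \<le> a + c)"
    unfolding plus_ordinal_le_iff[OF inf_sum] by (auto simp: not_le not_less)
  then obtain e where "e < b" "d \<le> a + e"
    using \<open>c < b\<close> le_plus_left[of a c] by (meson less_imp_le order_trans)
  moreover obtain f where "f < b" "e < f"
    using assms \<open>e < b\<close> by (auto simp: is_limit_def)
  ultimately show "\<exists>c<a + b. d < c"
    by (meson less_plus_ordinal[OF inf_sum] le_less_trans)
qed

lemma trans_iter_mono:
  fixes a :: "('s + nat) ordinal"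
  assumes "\<And>A B. A \<subseteq> B \<Longrightarrow> D A \<subseteq> E B" "A \<subseteq> B"
  shows "trans_iter D A a \<subseteq> trans_iter E B a"
proof (induction a rule: ordinal_induct)
  case zero
  then show ?case using assms(2) by (simp add: trans_iter_zero)
next
  case (succ a)
  then show ?case by (simp add: trans_iter_succ assms(1))
next
  case (limit a)
  then show ?case by (fastforce simp: trans_iter_limit)
qed

text \<open>At a limit \<open>b\<close> the sums \<open>a + c\<close> with \<open>c < b\<close> are
  cofinal in \<open>a + b\<close>, so both intersections agree. \<open>D\<close> is only asked to
  shrink the stages themselves, since \<open>convex_sigma_deriv\<close> shrinks closed convex sets
  but not arbitrary ones.\<close>

lemma trans_iter_plus:
  fixes a b :: "('s + nat) ordinal"
  assumes D: "\<And>c :: ('s + nat) ordinal. D (trans_iter D A c) \<subseteq> trans_iter D A c"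
  shows "trans_iter D A (a + b) = trans_iter D (trans_iter D A a) b"
proof (induction b rule: ordinal_induct)
  case zero
  show ?case by (simp add: trans_iter_zero ordinal_arithmetic)
next
  case (succ b)
  then show ?case by (simp add: trans_iter_succ ordinal_arithmetic)
next
  case (limit b)
  have "trans_iter D A (a + b) = (\<Inter>c<b. trans_iter D A (a + c))"
  proof (intro equalityI subsetI)
    fix z assume "z \<in> trans_iter D A (a + b)"
    then show "z \<in> (\<Inter>c<b. trans_iter D A (a + c))"
      using trans_iter_antimono[of D A, OF D plus_mono_right] by (meson INT_I lessThan_iff less_imp_le subsetD)
  next
    fix z assume z: "z \<in> (\<Inter>c<b. trans_iter D A (a + c))"
    obtain c0 where c0: "c0 < b"
      using limit by (auto simp: is_limit_def)
    have "z \<in> trans_iter D A d" if "d < a + b" for d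
    proof -
      have "\<not> a + b \<le> d" using that by simp
      then have "d < a \<or> (\<exists>c<b. d \<le> a + c)"
        unfolding plus_ordinal_le_iff[OF inf_sum] by (auto simp: not_le not_less)
      then obtain e where "e < b" "d \<le> a + e"
        using c0 le_plus_left[of a c0] by (meson less_imp_le order_trans)
      then show ?thesis
        using z trans_iter_antimono[of D A, OF D \<open>d \<le> a + e\<close>] by auto
    qed
    then show "z \<in> trans_iter D A (a + b)"
      by (simp add: trans_iter_limit is_limit_plus limit)
  qed
  also have "\<dots> = trans_iter D (trans_iter D A a) b"
    using limit by (simp add: trans_iter_limit)
  finally show ?case .
qed

text \<open>These are the powers \<omega>^\<alpha> with \<alpha> any ordinal, \<open>1\<close> being
  the smallest. Testing \<open>a + a\<close> is enough, since a sum of two ordinals is at most twice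
  the larger one.\<close>

definition indecomposable :: "('s + nat) ordinal \<Rightarrow> bool" where
  "indecomposable g \<longleftrightarrow> 0 < g \<and> (\<forall>a<g. a + a < g)"

text \<open>A successor \<open>succ b\<close> with \<open>0 < b\<close> is excluded:
  \<open>b + b\<close> would lie below it, hence be at most \<open>b\<close>. The two cases are the
  base and the step of the induction in \<open>convex_iter_slice\<close>.\<close>

lemma indecomposable_cases:
  assumes "indecomposable g"
  obtains "g = 1" | "is_limit g"
proof -
  have "is_limit g" if "g \<noteq> 1"
  proof (rule ccontr)
    assume "\<not> is_limit g"
    moreover have "0 < g" using assms by (simp add: indecomposable_def)
    ultimately obtain b where b: "b < g" "\<And>c. c < g \<Longrightarrow> c \<le> b"
      unfolding is_limit_def by (meson not_less)
    have g: "g = succ b"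
      using b by (rule eq_succI)
    show False
    proof (cases "b = 0")
      case True
      then show ?thesis using g that ordinal_arithmetic(5)[where 'i="'a + nat"] by simp
    next
      case False
      then have "0 < b"
        using zero_ordinal_least[of b] by (simp add: le_less)
      then have "b + 0 < b + b" by (rule less_plus_ordinal[rotated]) simp
      moreover have "b + b < g" using assms b by (simp add: indecomposable_def)
      ultimately show ?thesis
        using b(2) by (simp add: ordinal_arithmetic leD)
    qed
  qed
  then show ?thesis using that by blast
qed

text \<open>Every \<open>b > 0\<close> is at most \<open>d * N\<close> for some indecomposable \<open>d \<le> b\<close> and finite \<open>N\<close>; stated
  for iterations to avoid ordinal arithmetic.\<close>

lemma iterate_indecomposable_le:
  fixes b :: "('s + nat) ordinal"
  assumes mono: "\<And>A B. A \<subseteq> B \<Longrightarrow> D A \<subseteq> D B" and D: "\<And>A. D A \<subseteq> A" and "0 < b"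
  shows "\<exists>d N. indecomposable d \<and> d \<le> b \<and>
           (\<forall>A. ((\<lambda>B. trans_iter D B d) ^^ N) A \<subseteq> trans_iter D A b)"
  using \<open>0 < b\<close>
proof (induction b rule: less_induct)
  case (less b)
  show ?case
  proof (cases "indecomposable b")
    case True
    then show ?thesis by (intro exI[of _ b] exI[of _ 1]) simp
  next
    case False
    with less.prems obtain a where a: "a < b" "b \<le> a + a"
      by (auto simp: indecomposable_def not_less)
    then have "0 < a"
      using less.prems zero_ordinal_least[of a] by (metis le_less ordinal_arithmetic(1)[OF inf_sum] leD)
    from less.IH[OF a(1) this] obtain d N where d: "indecomposable d" "d \<le> a"
      and N: "\<And>A. ((\<lambda>B. trans_iter D B d) ^^ N) A \<subseteq> trans_iter D A a"
      by blast
    have "((\<lambda>B. trans_iter D B d) ^^ (N + N)) A \<subseteq> trans_iter D A b" for A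
    proof -
      have "((\<lambda>B. trans_iter D B d) ^^ (N + N)) A
          \<subseteq> trans_iter D (((\<lambda>B. trans_iter D B d) ^^ N) A) a"
        using N by (simp add: funpow_add)
      also have "\<dots> \<subseteq> trans_iter D (trans_iter D A a) a"
        by (rule trans_iter_mono[OF mono N])
      also have "\<dots> = trans_iter D A (a + a)"
        by (rule trans_iter_plus[symmetric, OF D])
      also have "\<dots> \<subseteq> trans_iter D A b"
        by (rule trans_iter_antimono[OF D a(2)])
      finally show ?thesis .
    qed
    with d a show ?thesis
      by (meson le_less_trans less_imp_le)
  qed
qed

text \<open>Finitely many blocks of \<open>d\<close> steps never reach \<open>g\<close>, so a point
  of stage \<open>g\<close> lies in the result of each of them.\<close>

lemma trans_iter_le_iterate:
  fixes g :: "('s + nat) ordinal"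
  assumes D: "\<And>c :: ('s + nat) ordinal. D (trans_iter D A c) \<subseteq> trans_iter D A c"
    and g: "indecomposable g" and d: "d < g"
  shows "\<exists>b<g. ((\<lambda>B. trans_iter D B d) ^^ j) A = trans_iter D A b"
proof -
  \<comment> \<open>Carrying \<open>d \<le> b\<close> along yields
    \<open>b + d \<le> b + b < g\<close>. Stage 0 need not satisfy it, so counting starts at one
    block.\<close>
  have "\<exists>b<g. d \<le> b \<and> ((\<lambda>B. trans_iter D B d) ^^ Suc j) A = trans_iter D A b" for j
  proof (induction j)
    case 0
    show ?case using d by auto
  next
    case (Suc j)
    then obtain b where b: "b < g" "d \<le> b" "((\<lambda>B. trans_iter D B d) ^^ Suc j) A = trans_iter D A b"
      by blast
    have "((\<lambda>B. trans_iter D B d) ^^ Suc (Suc j)) A = trans_iter D A (b + d)"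
      using b(3) by (simp add: trans_iter_plus[OF D])
    moreover have "b + d < g"
      using b g plus_mono_right[OF b(2), of b] by (auto simp: indecomposable_def intro: le_less_trans)
    moreover have "d \<le> b + d"
      using b(2) le_plus_left order_trans by blast
    ultimately show ?case by blast
  qed
  moreover have "\<exists>b<g. ((\<lambda>B. trans_iter D B d) ^^ 0) A = trans_iter D A b"
    using g by (auto simp: indecomposable_def trans_iter_zero)
  ultimately show ?thesis
    by (cases j) blast+
qed

subsection \<open>The weak-star topology\<close>

definition wball :: "'a :: real_normed_vector dual \<Rightarrow> 'a set \<Rightarrow> real \<Rightarrow> 'a dual set" where
  "wball y X r = {z. \<forall>x\<in>X. \<bar>blinfun_apply z x - blinfun_apply y x\<bar> < r}"

lemma openin_wball:
  assumes "finite X"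
  shows "openin weak_star (wball y X r)"
proof -
  have "openin weak_star {z. \<forall>x\<in>X. blinfun_apply z x \<in> ball (blinfun_apply y x) r}"
    by (rule strong_operator_topology_basis[OF assms]) simp
  then show ?thesis
    by (simp add: wball_def dist_real_def abs_minus_commute)
qed

lemma wball_self: "0 < r \<Longrightarrow> y \<in> wball y X r"
  by (simp add: wball_def)

lemma weak_star_open_contains_wball:
  fixes y :: "'a :: real_normed_vector dual"
  assumes "openin weak_star U" "y \<in> U"
  obtains X r where "finite X" "0 < r" "wball y X r \<subseteq> U"
proof -
  obtain V where V: "open V" "U = blinfun_apply -` V"
    using assms(1) unfolding strong_operator_topology_def openin_pullback_topology by auto
  then have "openin (product_topology (\<lambda>_. euclidean) UNIV) V" "blinfun_apply y \<in> V"
    using assms(2) by (auto simp: euclidean_product_topology)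
  from product_topology_open_contains_basis[OF this] obtain W
    where W: "blinfun_apply y \<in> (\<Pi>\<^sub>E i\<in>UNIV. W i)" "\<And>i. open (W i)"
      "finite {i. W i \<noteq> UNIV}" "(\<Pi>\<^sub>E i\<in>UNIV. W i) \<subseteq> V"
    by auto
  define X where "X = {i. W i \<noteq> UNIV}"
  have "\<exists>e>0. ball (blinfun_apply y i) e \<subseteq> W i" for i
    using W(1,2) by (auto simp: open_contains_ball)
  then obtain e where e: "\<And>i. e i > 0" "\<And>i. ball (blinfun_apply y i) (e i) \<subseteq> W i"
    by metis
  \<comment> \<open>The extra \<open>1\<close> keeps the minimum meaningful when \<open>X\<close> is
    empty.\<close>
  define r where "r = Min (insert 1 (e ` X))"
  have "finite X" using W(3) by (simp add: X_def)
  then have r: "r > 0" "\<And>i. i \<in> X \<Longrightarrow> r \<le> e i"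
    using e(1) by (auto simp: r_def)
  have "wball y X r \<subseteq> U"
  proof
    fix z assume z: "z \<in> wball y X r"
    have "blinfun_apply z i \<in> W i" for i
    proof (cases "i \<in> X")
      case True
      then have "blinfun_apply z i \<in> ball (blinfun_apply y i) (e i)"
        using z r(2)[of i] by (force simp: wball_def dist_real_def)
      then show ?thesis using e(2) by blast
    qed (simp add: X_def)
    then have "blinfun_apply z \<in> V" using W(4) by auto
    then show "z \<in> U" by (simp add: V(2))
  qed
  then show ?thesis using that \<open>finite X\<close> r(1) by blast
qed

lemma closedin_weak_star_le: "closedin weak_star {z. blinfun_apply z x \<le> c}"
proof -
  have "closedin weak_star {z \<in> topspace weak_star. blinfun_apply z x \<in> {..c}}"
    by (rule closedin_continuous_map_preimage[OF strong_operator_topology_continuous_evaluation]) simp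
  then show ?thesis by (simp add: strong_operator_topology_topspace)
qed

text \<open>Arbitrary \<open>X\<close> and a radius depending on the point make norm balls the
  special case where \<open>X\<close> is the whole space.\<close>

lemma closedin_weak_star_wcball:
  "closedin weak_star {z. \<forall>x\<in>X. \<bar>blinfun_apply z x - blinfun_apply y x\<bar> \<le> r x}"
proof -
  have "closedin weak_star {z. \<bar>blinfun_apply z x - blinfun_apply y x\<bar> \<le> r x}" for x
  proof -
    have "closedin weak_star {z \<in> topspace weak_star. blinfun_apply z x \<in> cball (blinfun_apply y x) (r x)}"
      by (rule closedin_continuous_map_preimage[OF strong_operator_topology_continuous_evaluation]) simp
    then show ?thesis
      by (simp add: strong_operator_topology_topspace dist_real_def abs_minus_commute)
  qed
  \<comment> \<open>The index \<open>0\<close> makes the family nonempty even if \<open>X\<close> is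
    empty; outside \<open>X\<close> it contributes the whole space.\<close>
  then have "closedin weak_star
      (\<Inter>x\<in>insert 0 X. if x \<in> X then {z. \<bar>blinfun_apply z x - blinfun_apply y x\<bar> \<le> r x} else UNIV)"
    using closedin_topspace[of "weak_star :: 'a dual topology"]
    by (intro closedin_Inter) (auto simp: strong_operator_topology_topspace)
  moreover have "(\<Inter>x\<in>insert 0 X. if x \<in> X then {z. \<bar>blinfun_apply z x - blinfun_apply y x\<bar> \<le> r x} else UNIV)
      = {z. \<forall>x\<in>X. \<bar>blinfun_apply z x - blinfun_apply y x\<bar> \<le> r x}"
    by auto
  ultimately show ?thesis by simp
qed

lemma cball_eq_wcball:
  "cball c r = {z. \<forall>x. \<bar>blinfun_apply z x - blinfun_apply c x\<bar> \<le> r * norm x}"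
    (is "_ = ?R") if "0 \<le> r" for c :: "'a :: real_normed_vector dual"
proof (intro equalityI subsetI)
  fix z assume z: "z \<in> cball c r"
  show "z \<in> ?R"
  proof safe
    fix x
    have "norm (blinfun_apply (z - c) x) \<le> norm (z - c) * norm x" by (rule norm_blinfun)
    also have "\<dots> \<le> r * norm x"
      using z by (intro mult_right_mono) (simp_all add: dist_norm norm_minus_commute)
    finally show "\<bar>blinfun_apply z x - blinfun_apply c x\<bar> \<le> r * norm x"
      by (simp add: blinfun.diff_left)
  qed
next
  fix z assume "z \<in> ?R"
  then have "norm (z - c) \<le> r"
    by (intro norm_blinfun_bound that) (simp add: blinfun.diff_left)
  then show "z \<in> cball c r" by (simp add: dist_norm norm_minus_commute)
qed

lemma closedin_weak_star_cball: "closedin weak_star (cball c r)"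
proof (cases "0 \<le> r")
  case True
  then show ?thesis
    using closedin_weak_star_wcball[of UNIV c "\<lambda>x. r * norm x"] by (simp add: cball_eq_wcball)
next
  case False
  then show ?thesis by simp
qed

lemma Hausdorff_space_weak_star: "Hausdorff_space weak_star"
  unfolding Hausdorff_space_def
proof (intro allI impI, elim conjE)
  fix y z :: "'a dual" assume "y \<noteq> z"
  then obtain x where x: "blinfun_apply y x \<noteq> blinfun_apply z x"
    using blinfun_eqI by blast
  define r where "r = \<bar>blinfun_apply y x - blinfun_apply z x\<bar> / 2"
  have "disjnt (wball y {x} r) (wball z {x} r)"
    unfolding disjnt_def wball_def r_def by (auto simp: field_simps abs_if split: if_splits)
  moreover have "0 < r" using x by (simp add: r_def)
  ultimately show "\<exists>U V. openin weak_star U \<and> openin weak_star V \<and> y \<in> U \<and> z \<in> V \<and> disjnt U V"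
    by (intro exI[of _ "wball y {x} r"] exI[of _ "wball z {x} r"]) (simp add: openin_wball wball_self)
qed

lemma weak_star_regular:
  assumes "openin weak_star U" "y \<in> U"
  obtains V where "openin weak_star V" "y \<in> V" "weak_star closure_of V \<subseteq> U"
proof -
  obtain X r where X: "finite X" "0 < r" "wball y X r \<subseteq> U"
    using weak_star_open_contains_wball[OF assms] by blast
  have "weak_star closure_of (wball y X (r / 2))
      \<subseteq> {z. \<forall>x\<in>X. \<bar>blinfun_apply z x - blinfun_apply y x\<bar> \<le> r / 2}"
    by (rule closure_of_minimal[OF _ closedin_weak_star_wcball]) (auto simp: wball_def less_imp_le)
  also have "\<dots> \<subseteq> wball y X r"
    using X(2) by (force simp: wball_def)
  finally show ?thesis
    using that[of "wball y X (r / 2)"] X openin_wball[OF X(1)] wball_self[of "r / 2" y X] by force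
qed

lemma in_weak_star_closure_iff:
  fixes y :: "'a :: real_normed_vector dual"
  shows "y \<in> weak_star closure_of S \<longleftrightarrow> (\<forall>X r. finite X \<and> 0 < r \<longrightarrow> (\<exists>z\<in>S. z \<in> wball y X r))"
proof
  assume "y \<in> weak_star closure_of S"
  then show "\<forall>X r. finite X \<and> 0 < r \<longrightarrow> (\<exists>z\<in>S. z \<in> wball y X r)"
    unfolding in_closure_of by (meson openin_wball wball_self)
next
  assume *: "\<forall>X r. finite X \<and> 0 < r \<longrightarrow> (\<exists>z\<in>S. z \<in> wball y X r)"
  show "y \<in> weak_star closure_of S"
    unfolding in_closure_of
  proof (intro conjI allI impI)
    fix U assume "y \<in> U \<and> openin weak_star U"
    then obtain X r where "finite X" "0 < r" "wball y X r \<subseteq> U"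
      using weak_star_open_contains_wball by blast
    with * show "\<exists>z. z \<in> S \<and> z \<in> U" by blast
  qed (simp add: strong_operator_topology_topspace)
qed

lemma convex_weak_star_closure:
  fixes S :: "'a :: real_normed_vector dual set"
  assumes "convex S"
  shows "convex (weak_star closure_of S)"
  unfolding convex_alt
proof (intro ballI allI impI)
  fix y z and u :: real
  assume y: "y \<in> weak_star closure_of S" and z: "z \<in> weak_star closure_of S" and u: "0 \<le> u \<and> u \<le> 1"
  show "(1 - u) *\<^sub>R y + u *\<^sub>R z \<in> weak_star closure_of S"
    unfolding in_weak_star_closure_iff
  proof (intro allI impI)
    fix X :: "'a set" and r :: real assume "finite X \<and> 0 < r"
    then obtain y' z' where S: "y' \<in> S" "z' \<in> S" and w: "y' \<in> wball y X r" "z' \<in> wball z X r"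
      using y z unfolding in_weak_star_closure_iff by blast
    have "(1 - u) *\<^sub>R y' + u *\<^sub>R z' \<in> wball ((1 - u) *\<^sub>R y + u *\<^sub>R z) X r"
      unfolding wball_def
    proof safe
      fix x assume "x \<in> X"
      then have a: "\<bar>blinfun_apply y' x - blinfun_apply y x\<bar> < r"
        and b: "\<bar>blinfun_apply z' x - blinfun_apply z x\<bar> < r"
        using w by (auto simp: wball_def)
      have "blinfun_apply ((1 - u) *\<^sub>R y' + u *\<^sub>R z') x - blinfun_apply ((1 - u) *\<^sub>R y + u *\<^sub>R z) x
        = (1 - u) * (blinfun_apply y' x - blinfun_apply y x) + u * (blinfun_apply z' x - blinfun_apply z x)"
        by (simp add: blinfun.add_left blinfun.scaleR_left) (simp add: algebra_simps)
      moreover have "(1 - u) *\<^sub>R (blinfun_apply y' x - blinfun_apply y x) + u *\<^sub>R (blinfun_apply z' x - blinfun_apply z x) \<in> {-r<..<r}"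
        by (rule convexD_alt) (use a b u in auto)
      ultimately show "\<bar>blinfun_apply ((1 - u) *\<^sub>R y' + u *\<^sub>R z') x - blinfun_apply ((1 - u) *\<^sub>R y + u *\<^sub>R z) x\<bar> < r"
        by (simp add: abs_less_iff)
    qed
    moreover have "(1 - u) *\<^sub>R y' + u *\<^sub>R z' \<in> S"
      using assms S u by (auto simp: convex_alt)
    ultimately show "\<exists>w\<in>S. w \<in> wball ((1 - u) *\<^sub>R y + u *\<^sub>R z) X r" by blast
  qed
qed

subsection \<open>The derivations\<close>

lemma kuratowski_less_iff:
  "kuratowski A < ereal e \<longleftrightarrow>
     (\<exists>d C. 0 < d \<and> d < e \<and> finite C \<and> A \<subseteq> (\<Union>c\<in>C. cball c (d / 2)))"
  unfolding kuratowski_def Inf_less_iff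
proof
  assume "\<exists>x\<in>{ereal d |d. 0 < d \<and> (\<exists>C. finite C \<and> A \<subseteq> (\<Union>c\<in>C. cball c (d / 2)))}. x < ereal e"
  then show "\<exists>d C. 0 < d \<and> d < e \<and> finite C \<and> A \<subseteq> (\<Union>c\<in>C. cball c (d / 2))"
    by auto
next
  assume "\<exists>d C. 0 < d \<and> d < e \<and> finite C \<and> A \<subseteq> (\<Union>c\<in>C. cball c (d / 2))"
  then obtain d C where "0 < d" "d < e" "finite C" "A \<subseteq> (\<Union>c\<in>C. cball c (d / 2))" by blast
  then show "\<exists>x\<in>{ereal d |d. 0 < d \<and> (\<exists>C. finite C \<and> A \<subseteq> (\<Union>c\<in>C. cball c (d / 2)))}. x < ereal e"
    by (intro bexI[of _ "ereal d"]) auto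
qed

lemma kuratowski_mono: "A \<subseteq> B \<Longrightarrow> kuratowski A \<le> kuratowski B"
  unfolding kuratowski_def by (rule Inf_superset_mono) blast

lemma kuratowski_empty: "0 < e \<Longrightarrow> kuratowski {} < ereal e"
  unfolding kuratowski_less_iff by (intro exI[of _ "e / 2"] exI[of _ "{}"]) simp

lemma kuratowski_Un:
  assumes "kuratowski A < ereal e" "kuratowski B < ereal e"
  shows "kuratowski (A \<union> B) < ereal e"
proof -
  obtain a C b D where a: "0 < a" "a < e" "finite C" "A \<subseteq> (\<Union>c\<in>C. cball c (a / 2))"
    and b: "0 < b" "b < e" "finite D" "B \<subseteq> (\<Union>c\<in>D. cball c (b / 2))"
    using assms unfolding kuratowski_less_iff by blast
  have "A \<union> B \<subseteq> (\<Union>c\<in>C \<union> D. cball c (max a b / 2))"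
    using a(4) b(4) by fastforce
  with a b show ?thesis
    unfolding kuratowski_less_iff
    by (intro exI[of _ "max a b"] exI[of _ "C \<union> D"]) auto
qed

text \<open>Regularity of the weak-star topology lets open neighbourhoods replace closures of
  neighbourhoods; open sets are easier to intersect and to pull back.\<close>

lemma sigma_deriv_iff:
  "y \<in> sigma_deriv e A \<longleftrightarrow>
     y \<in> A \<and> (\<forall>U. openin weak_star U \<and> y \<in> U \<longrightarrow> ereal e \<le> kuratowski (A \<inter> U))"
proof (intro iffI conjI allI impI; (elim conjE)?)
  assume y: "y \<in> sigma_deriv e A"
  then show "y \<in> A" by (simp add: sigma_deriv_def)
  fix U assume "openin weak_star U" "y \<in> U"
  then obtain V where V: "openin weak_star V" "y \<in> V" "weak_star closure_of V \<subseteq> U"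
    by (rule weak_star_regular)
  then have "ereal e \<le> kuratowski (A \<inter> weak_star closure_of V)"
    using y by (auto simp: sigma_deriv_def weak_star_nhd_def)
  also have "\<dots> \<le> kuratowski (A \<inter> U)"
    using V(3) by (intro kuratowski_mono) blast
  finally show "ereal e \<le> kuratowski (A \<inter> U)" .
next
  assume "y \<in> A" and *: "\<forall>U. openin weak_star U \<and> y \<in> U \<longrightarrow> ereal e \<le> kuratowski (A \<inter> U)"
  have "ereal e \<le> kuratowski (A \<inter> weak_star closure_of U)" if nhd: "weak_star_nhd y U" for U
  proof -
    obtain V where V: "openin weak_star V" "y \<in> V" "V \<subseteq> U"
      using nhd by (auto simp: weak_star_nhd_def)
    then have "ereal e \<le> kuratowski (A \<inter> V)" using * by blast
    also have "\<dots> \<le> kuratowski (A \<inter> weak_star closure_of U)"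
      using V closure_of_subset[of U weak_star]
      by (intro kuratowski_mono) (auto simp: strong_operator_topology_topspace)
    finally show ?thesis .
  qed
  with \<open>y \<in> A\<close> show "y \<in> sigma_deriv e A" by (simp add: sigma_deriv_def)
qed

lemma sigma_deriv_subset: "sigma_deriv e A \<subseteq> A"
  by (auto simp: sigma_deriv_def)

lemma sigma_deriv_mono:
  assumes "A \<subseteq> B" "d \<le> e"
  shows "sigma_deriv e A \<subseteq> sigma_deriv d B"
proof
  fix y assume y: "y \<in> sigma_deriv e A"
  have "ereal d \<le> kuratowski (B \<inter> U)" if "openin weak_star U" "y \<in> U" for U
  proof -
    have "ereal d \<le> ereal e" using assms by simp
    also have "\<dots> \<le> kuratowski (A \<inter> U)" using y that by (auto simp: sigma_deriv_iff)
    also have "\<dots> \<le> kuratowski (B \<inter> U)" using assms by (intro kuratowski_mono) blast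
    finally show ?thesis .
  qed
  then show "y \<in> sigma_deriv d B"
    using y assms by (auto simp: sigma_deriv_iff)
qed

lemma closedin_sigma_deriv:
  assumes "closedin weak_star A"
  shows "closedin weak_star (sigma_deriv e A)"
proof -
  have eq: "sigma_deriv e A = A - \<Union>{U. openin weak_star U \<and> kuratowski (A \<inter> U) < ereal e}"
    by (auto simp: sigma_deriv_iff not_le[symmetric])
  show ?thesis
    unfolding eq by (rule closedin_diff[OF assms], rule openin_Union) simp
qed

text \<open>If \<open>y\<close> is lost from both derivatives, intersecting the two witnessing
  neighbourhoods gives one on which the union has small measure. Closedness supplies a neighbourhood
  also when \<open>y\<close> lies outside one of the sets.\<close>

lemma sigma_deriv_Un:
  assumes A: "closedin weak_star A" and B: "closedin weak_star B" and e: "0 < e"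
  shows "sigma_deriv e (A \<union> B) \<subseteq> sigma_deriv e A \<union> sigma_deriv e B"
proof
  fix y assume y: "y \<in> sigma_deriv e (A \<union> B)"
  have *: "\<exists>U. openin weak_star U \<and> y \<in> U \<and> kuratowski (D \<inter> U) < ereal e"
    if D: "closedin weak_star D" "y \<notin> sigma_deriv e D" for D
  proof (cases "y \<in> D")
    case True
    then show ?thesis using D by (auto simp: sigma_deriv_iff not_le)
  next
    case False
    have "openin weak_star (UNIV - D)"
      using D(1) openin_diff openin_topspace strong_operator_topology_topspace by metis
    moreover have "D \<inter> (UNIV - D) = {}" by blast
    ultimately show ?thesis using False kuratowski_empty[OF e] by (intro exI[of _ "UNIV - D"]) simp
  qed
  show "y \<in> sigma_deriv e A \<union> sigma_deriv e B"
  proof (rule ccontr)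
    assume "y \<notin> sigma_deriv e A \<union> sigma_deriv e B"
    then obtain U V where U: "openin weak_star U" "y \<in> U" "kuratowski (A \<inter> U) < ereal e"
      and V: "openin weak_star V" "y \<in> V" "kuratowski (B \<inter> V) < ereal e"
      using *[OF A] *[OF B] by blast
    have "kuratowski ((A \<union> B) \<inter> (U \<inter> V)) \<le> kuratowski (A \<inter> U \<union> B \<inter> V)"
      by (rule kuratowski_mono) blast
    also have "\<dots> < ereal e" using U V by (intro kuratowski_Un)
    finally have "\<not> ereal e \<le> kuratowski ((A \<union> B) \<inter> (U \<inter> V))" by simp
    moreover have "openin weak_star (U \<inter> V)" "y \<in> U \<inter> V" using U V by auto
    ultimately show False using y unfolding sigma_deriv_iff by blast
  qed
qed

section \<open>Szlenk iterations of weak-star closed sets\<close>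

abbreviation szlenk_iter where "szlenk_iter e \<equiv> trans_iter (sigma_deriv e)"

abbreviation convex_iter where "convex_iter e \<equiv> trans_iter (convex_sigma_deriv e)"

lemma szlenk_iter_antimono:
  fixes a b :: "('s + nat) ordinal"
  shows "a \<le> b \<Longrightarrow> szlenk_iter e A b \<subseteq> szlenk_iter e A a"
  by (rule trans_iter_antimono[OF sigma_deriv_subset])

lemma szlenk_iter_subset: "szlenk_iter e A (a :: ('s + nat) ordinal) \<subseteq> A"
  using szlenk_iter_antimono[OF zero_ordinal_least] trans_iter_zero by metis

lemma closedin_szlenk_iter:
  fixes a :: "('s + nat) ordinal"
  assumes "closedin weak_star A"
  shows "closedin weak_star (szlenk_iter e A a)"
proof (induction a rule: ordinal_induct)
  case (limit a)
  then have "{..<a} \<noteq> {}" by (auto simp: is_limit_def)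
  then show ?case
    using limit unfolding trans_iter_limit[OF limit(1)] by (intro closedin_Inter) auto
qed (simp_all add: trans_iter_zero trans_iter_succ closedin_sigma_deriv assms)

text \<open>At a limit, a point lost from the two iterations at stages \<open>b\<close> and
  \<open>c\<close> is lost from both at \<open>max b c\<close>.\<close>

lemma szlenk_iter_Un:
  fixes a :: "('s + nat) ordinal"
  assumes "closedin weak_star A" "closedin weak_star B" "0 < e"
  shows "szlenk_iter e (A \<union> B) a \<subseteq> szlenk_iter e A a \<union> szlenk_iter e B a"
proof (induction a rule: ordinal_induct)
  case zero
  show ?case by (simp add: trans_iter_zero)
next
  case (succ a)
  have "sigma_deriv e (szlenk_iter e (A \<union> B) a)
      \<subseteq> sigma_deriv e (szlenk_iter e A a \<union> szlenk_iter e B a)"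
    by (rule sigma_deriv_mono[OF succ order_refl])
  also have "\<dots> \<subseteq> sigma_deriv e (szlenk_iter e A a) \<union> sigma_deriv e (szlenk_iter e B a)"
    by (intro sigma_deriv_Un closedin_szlenk_iter assms)
  finally show ?case by (simp add: trans_iter_succ)
next
  case (limit a)
  show ?case
  proof
    fix z assume "z \<in> szlenk_iter e (A \<union> B) a"
    then have z: "z \<in> szlenk_iter e A b \<or> z \<in> szlenk_iter e B b" if "b < a" for b
      using limit that by (auto simp: trans_iter_limit)
    show "z \<in> szlenk_iter e A a \<union> szlenk_iter e B a"
    proof (rule ccontr)
      assume "z \<notin> szlenk_iter e A a \<union> szlenk_iter e B a"
      then obtain b c where "b < a" "z \<notin> szlenk_iter e A b" "c < a" "z \<notin> szlenk_iter e B c"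
        using limit by (auto simp: trans_iter_limit)
      then show False
        using z[of "max b c"] szlenk_iter_antimono[of b "max b c" e A] szlenk_iter_antimono[of c "max b c" e B]
        by auto
    qed
  qed
qed

lemma szlenk_iter_empty: "szlenk_iter e {} (a :: ('s + nat) ordinal) = {}"
  using szlenk_iter_subset by blast

lemma szlenk_iter_UN_empty:
  fixes a :: "('s + nat) ordinal"
  assumes "finite I" "0 < e"
    and "\<And>i. i \<in> I \<Longrightarrow> closedin weak_star (A i)" "\<And>i. i \<in> I \<Longrightarrow> szlenk_iter e (A i) a = {}"
  shows "szlenk_iter e (\<Union>i\<in>I. A i) a = {}"
  using assms
proof (induction I rule: finite_induct)
  case empty
  show ?case by (simp add: szlenk_iter_empty)
next
  case (insert i I)
  then have "szlenk_iter e (A i \<union> (\<Union>j\<in>I. A j)) a \<subseteq> szlenk_iter e (A i) a \<union> szlenk_iter e (\<Union>j\<in>I. A j) a"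
    by (intro szlenk_iter_Un closedin_Union) auto
  with insert show ?case by auto
qed

text \<open>The stages are nested and closed in a compact set, so if all those before the limit are
  nonempty, their intersection is nonempty too.\<close>

lemma szlenk_iter_limit_empty:
  fixes a :: "('s + nat) ordinal"
  assumes A: "compactin weak_star A" and a: "is_limit a" and empty: "szlenk_iter e A a = {}"
  shows "\<exists>b<a. szlenk_iter e A b = {}"
proof (rule ccontr)
  assume "\<not> (\<exists>b<a. szlenk_iter e A b = {})"
  then have ne: "szlenk_iter e A b \<noteq> {}" if "b < a" for b using that by blast
  obtain b0 where b0: "b0 < a" using a by (auto simp: is_limit_def)
  let ?\<U> = "szlenk_iter e A ` {..<a}"
  have closed: "closedin weak_star A"
    using A Hausdorff_space_weak_star compactin_imp_closedin by blast
  have "A \<inter> \<Inter>\<F> \<noteq> {}" if F: "finite \<F>" "\<F> \<subseteq> ?\<U>" for \<F>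
  proof -
    obtain B where B: "finite B" "B \<subseteq> {..<a}" "\<F> = szlenk_iter e A ` B"
      using F by (metis finite_subset_image)
    define m where "m = Max (insert b0 B)"
    have "m \<in> insert b0 B" unfolding m_def using B(1) by (intro Max_in) auto
    then have "m < a" using B b0 by auto
    have "szlenk_iter e A m \<subseteq> szlenk_iter e A b" if "b \<in> B" for b
      using that B(1) by (intro szlenk_iter_antimono) (simp add: m_def)
    then have "szlenk_iter e A m \<subseteq> A \<inter> \<Inter>\<F>"
      using szlenk_iter_subset[of e A m] by (auto simp: B(3))
    with ne[OF \<open>m < a\<close>] show ?thesis by blast
  qed
  moreover have "\<forall>C\<in>?\<U>. closedin weak_star C" using closedin_szlenk_iter[OF closed] by blast
  ultimately have "A \<inter> \<Inter>?\<U> \<noteq> {}"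
    using A unfolding compactin_fip by blast
  then show False using a empty by (auto simp: trans_iter_limit)
qed

section \<open>Convex derivations of weak-star closed convex sets\<close>

lemma convex_sigma_deriv_subset:
  assumes "closedin weak_star A" "convex A"
  shows "convex_sigma_deriv e A \<subseteq> A"
proof -
  have "convex hull (sigma_deriv e A) \<subseteq> A"
    by (rule hull_minimal[of "sigma_deriv e A" A convex]) (fact sigma_deriv_subset, fact assms)
  then show ?thesis
    unfolding convex_sigma_deriv_def by (rule closure_of_minimal[OF _ assms(1)])
qed

lemma sigma_deriv_subset_convex: "sigma_deriv e A \<subseteq> convex_sigma_deriv e A"
proof -
  have "convex hull (sigma_deriv e A) \<subseteq> weak_star closure_of (convex hull (sigma_deriv e A))"
    by (rule closure_of_subset) (simp add: strong_operator_topology_topspace)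
  then show ?thesis
    unfolding convex_sigma_deriv_def using hull_subset[of "sigma_deriv e A" convex] by (rule order_trans[rotated])
qed

lemma closed_convex_iter:
  fixes a :: "('s + nat) ordinal"
  assumes A: "closedin weak_star A" "convex A"
  shows "closedin weak_star (convex_iter e A a) \<and> convex (convex_iter e A a)"
proof (induction a rule: ordinal_induct)
  case zero
  show ?case using A by (simp add: trans_iter_zero)
next
  case (succ a)
  show ?case
    by (simp add: trans_iter_succ convex_sigma_deriv_def convex_weak_star_closure)
next
  case (limit a)
  then have "{..<a} \<noteq> {}" by (auto simp: is_limit_def)
  then show ?case
    using limit unfolding trans_iter_limit[OF limit(1)]
    by (intro conjI closedin_Inter convex_INT) auto
qed

lemma convex_iter_decreasing:
  fixes a :: "('s + nat) ordinal"
  assumes "closedin weak_star A" "convex A"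
  shows "convex_sigma_deriv e (convex_iter e A a) \<subseteq> convex_iter e A a"
  using closed_convex_iter[OF assms] convex_sigma_deriv_subset by blast

lemma convex_iter_antimono:
  fixes a b :: "('s + nat) ordinal"
  assumes "closedin weak_star A" "convex A" "a \<le> b"
  shows "convex_iter e A b \<subseteq> convex_iter e A a"
  by (rule trans_iter_antimono[OF convex_iter_decreasing[OF assms(1,2)] assms(3)])

subsection \<open>Finitely supported probabilities and affine minorants\<close>

text \<open>Finitely supported probabilities replace representing measures. They represent a point
  only approximately, on finitely many coordinates, which avoids integration altogether.\<close>

definition prob_on :: "'b set \<Rightarrow> ('b \<Rightarrow> real) set" where
  "prob_on A = {m. finite {a. m a \<noteq> 0} \<and> {a. m a \<noteq> 0} \<subseteq> A \<and> (\<forall>a. 0 \<le> m a) \<and> (\<Sum>a | m a \<noteq> 0. m a) = 1}"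

definition expect :: "('b \<Rightarrow> real) \<Rightarrow> ('b \<Rightarrow> real) \<Rightarrow> real" where
  "expect m f = (\<Sum>a | m a \<noteq> 0. m a * f a)"

lemma expect_eq_sum:
  assumes "finite S" "{a. m a \<noteq> 0} \<subseteq> S"
  shows "expect m f = (\<Sum>a\<in>S. m a * f a)"
  unfolding expect_def using assms by (intro sum.mono_neutral_left) auto

lemma expect_add: "expect m (\<lambda>a. f a + g a) = expect m f + expect m g"
  by (simp add: expect_def sum.distrib algebra_simps)

lemma expect_diff: "expect m (\<lambda>a. f a - g a) = expect m f - expect m g"
  by (simp add: expect_def sum_subtractf algebra_simps)

lemma expect_cmult: "expect m (\<lambda>a. c * f a) = c * expect m f"
  by (simp add: expect_def sum_distrib_left mult.left_commute)

lemma expect_const: "m \<in> prob_on A \<Longrightarrow> expect m (\<lambda>_. c) = c"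
  by (simp add: expect_def prob_on_def flip: sum_distrib_right)

lemma expect_mono:
  assumes "m \<in> prob_on A" "\<And>a. a \<in> A \<Longrightarrow> f a \<le> g a"
  shows "expect m f \<le> expect m g"
  unfolding expect_def using assms by (intro sum_mono mult_left_mono) (auto simp: prob_on_def)

lemma point_mass:
  assumes "y \<in> A"
  shows "(\<lambda>a. if a = y then 1 else 0) \<in> prob_on A" "expect (\<lambda>a. if a = y then 1 else 0) f = f y"
  using assms by (auto simp: prob_on_def expect_def)

lemma prob_mixture:
  fixes t :: real
  assumes m: "m \<in> prob_on A" and n: "n \<in> prob_on A" and t: "0 \<le> t" "t \<le> 1"
  shows "(\<lambda>a. (1 - t) * m a + t * n a) \<in> prob_on A"
    and "expect (\<lambda>a. (1 - t) * m a + t * n a) f = (1 - t) * expect m f + t * expect n f"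
proof -
  let ?mix = "\<lambda>a. (1 - t) * m a + t * n a"
  let ?S = "{a. m a \<noteq> 0} \<union> {a. n a \<noteq> 0}"
  have fin: "finite ?S" and sub: "?S \<subseteq> A" and nn: "\<And>a. 0 \<le> m a" "\<And>a. 0 \<le> n a"
    using m n by (auto simp: prob_on_def)
  have supp: "{a. ?mix a \<noteq> 0} \<subseteq> ?S" by auto
  show mix: "expect ?mix f = (1 - t) * expect m f + t * expect n f" for f
    unfolding expect_eq_sum[OF fin supp]
    by (subst (1 2) expect_eq_sum[OF fin])
      (auto simp: sum_distrib_left simp flip: sum.distrib intro!: sum.cong simp: algebra_simps)
  have "(\<Sum>a | ?mix a \<noteq> 0. ?mix a) = 1"
    using mix[of "\<lambda>_. 1"] m n by (simp add: expect_def prob_on_def)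
  then show "?mix \<in> prob_on A"
    using fin sub supp nn t by (auto simp: prob_on_def intro: finite_subset)
qed

section \<open>Separation in finite dimensions\<close>

lemma convex_separation:
  fixes W :: "('i \<Rightarrow> real) set" and I :: "'i set"
  assumes I: "finite I" and ne: "W \<noteq> {}"
    and conv: "\<And>u v t. u \<in> W \<Longrightarrow> v \<in> W \<Longrightarrow> 0 \<le> t \<Longrightarrow> t \<le> 1 \<Longrightarrow> (\<lambda>i. (1 - t) * u i + t * v i) \<in> W"
    and bound: "\<And>u i. u \<in> W \<Longrightarrow> i \<in> I \<Longrightarrow> \<bar>u i\<bar> \<le> B"
    and away: "0 < \<rho>" "\<And>u. u \<in> W \<Longrightarrow> \<rho> \<le> (\<Sum>i\<in>I. (u i)\<^sup>2)"
  shows "\<exists>p. \<forall>u\<in>W. 0 < (\<Sum>i\<in>I. p i * u i)"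
proof -
  define N where "N u = (\<Sum>i\<in>I. (u i)\<^sup>2)" for u :: "'i \<Rightarrow> real"
  define d where "d = Inf (N ` W)"
  \<comment> \<open>The summand \<open>1\<close> pays for the slack \<open>t\<^sup>2\<close> of the
    near-minimiser \<open>p\<close>; the rest bounds the squared distance from \<open>p\<close> to
    any \<open>w\<close>.\<close>
  define C where "C = 1 + real (card I) * (2 * B)\<^sup>2"
  define t where "t = min 1 (\<rho> / C)"
  have C: "1 \<le> C" by (simp add: C_def)
  have t: "0 < t" "t \<le> 1" "t * C \<le> \<rho>"
    using away(1) C by (auto simp: t_def min_def field_simps)
  have bdd: "bdd_below (N ` W)"
    using away(2) unfolding N_def by (intro bdd_belowI2[where m=\<rho>]) auto
  have d: "d \<le> N u" if "u \<in> W" for u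
    unfolding d_def using that bdd by (intro cInf_lower) auto
  have "Inf (N ` W) < d + t\<^sup>2" using t by (simp add: d_def)
  then obtain p where p: "p \<in> W" "N p < d + t\<^sup>2"
    using ne cInf_lessD[of "N ` W" "d + t\<^sup>2"] by auto
  have "0 < (\<Sum>i\<in>I. p i * w i)" if w: "w \<in> W" for w
  proof -
    \<comment> \<open>Moving from \<open>p\<close> a fraction \<open>t\<close> towards
      \<open>w\<close> stays in \<open>W\<close>, so the squared norm cannot fall below the infimum.
      As \<open>W\<close> need not be closed, \<open>p\<close> is only a near-minimiser.\<close>
    have "d \<le> N (\<lambda>i. (1 - t) * p i + t * w i)"
      using p w t by (intro d conv) auto
    also have "\<dots> = N p + 2 * t * ((\<Sum>i\<in>I. p i * w i) - N p) + t\<^sup>2 * (\<Sum>i\<in>I. (w i - p i)\<^sup>2)"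
      unfolding N_def sum_distrib_left sum_subtractf[symmetric] sum.distrib[symmetric]
      by (intro sum.cong) (auto simp: power2_eq_square algebra_simps)
    also have "(\<Sum>i\<in>I. (w i - p i)\<^sup>2) \<le> (\<Sum>i\<in>I. (2 * B)\<^sup>2)"
    proof (rule sum_mono)
      fix i assume "i \<in> I"
      with bound[OF w] bound[OF p(1)] have "\<bar>w i - p i\<bar> \<le> 2 * B"
        by (smt (verit))
      then show "(w i - p i)\<^sup>2 \<le> (2 * B)\<^sup>2"
        by (metis abs_ge_zero power2_abs power_mono)
    qed
    also have "(\<Sum>i\<in>I. (2 * B)\<^sup>2) = C - 1" by (simp add: C_def)
    finally have "d \<le> N p + 2 * t * ((\<Sum>i\<in>I. p i * w i) - N p) + t\<^sup>2 * (C - 1)"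
      by (simp add: mult_left_mono)
    with p(2) have "0 < 2 * t * ((\<Sum>i\<in>I. p i * w i) - N p) + t\<^sup>2 * C"
      by (simp add: algebra_simps)
    also have "\<dots> = t * (2 * ((\<Sum>i\<in>I. p i * w i) - N p) + t * C)"
      by (simp add: power2_eq_square algebra_simps)
    finally have "0 < 2 * ((\<Sum>i\<in>I. p i * w i) - N p) + t * C"
      using t(1) by (simp add: zero_less_mult_iff)
    moreover have "\<rho> \<le> N p" using away(2) p(1) by (simp add: N_def)
    ultimately have "\<rho> < 2 * (\<Sum>i\<in>I. p i * w i)" using t(3) by (simp add: algebra_simps)
    then show ?thesis using away(1) by simp
  qed
  then show ?thesis by blast
qed

section \<open>Affine minorants and the lower convex envelope\<close>

definition minorants :: "'a :: real_normed_vector dual set \<Rightarrow> ('a dual \<Rightarrow> real) \<Rightarrow> ('a \<times> real) set" where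
  "minorants K F = {(x, k). \<forall>a\<in>K. blinfun_apply a x + k \<le> F a}"

definition envelope :: "'a :: real_normed_vector dual set \<Rightarrow> ('a dual \<Rightarrow> real) \<Rightarrow> 'a dual \<Rightarrow> real" where
  "envelope K F y = (SUP (x, k)\<in>minorants K F. blinfun_apply y x + k)"

lemma minorant_le_envelope:
  assumes "(x, k) \<in> minorants K F" "y \<in> K"
  shows "blinfun_apply y x + k \<le> envelope K F y"
  unfolding envelope_def
  by (rule cSUP_upper2[where x="(x, k)"])
    (use assms in \<open>auto simp: minorants_def intro!: bdd_aboveI2[where M="F y"]\<close>)

lemma envelope_le:
  assumes "\<And>x k. (x, k) \<in> minorants K F \<Longrightarrow> blinfun_apply y x + k \<le> v" "\<And>a. a \<in> K \<Longrightarrow> - M \<le> F a"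
  shows "envelope K F y \<le> v"
  unfolding envelope_def
proof (rule cSUP_least)
  have "(0, - M) \<in> minorants K F" using assms(2) by (simp add: minorants_def)
  then show "minorants K F \<noteq> {}" by blast
qed (use assms(1) in auto)

text \<open>A Hahn-Banach argument that needs only the finitely many coordinates in \<open>X\<close> and the value of
  the cost, so that separation in a finite-dimensional space suffices.\<close>

lemma envelope_attained:
  fixes K :: "'a :: real_normed_vector dual set"
  assumes R: "\<And>a. a \<in> K \<Longrightarrow> norm a \<le> R" and M: "\<And>a. a \<in> K \<Longrightarrow> \<bar>F a\<bar> \<le> M"
    and y: "y \<in> K" and X: "finite X" and r: "0 < r" and s: "0 < s"
  shows "\<exists>m\<in>prob_on K. (\<forall>x\<in>X. \<bar>expect m (\<lambda>a. blinfun_apply a x) - blinfun_apply y x\<bar> < r)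
           \<and> expect m F \<le> envelope K F y + s"
proof (rule ccontr)
  assume contra: "\<not> ?thesis"
  define v0 where "v0 = envelope K F y + s / 2"
  define V where "V = max M (v0 + 1)"
  define u where "u m v i = (case i of None \<Rightarrow> v - v0
      | Some x \<Rightarrow> expect m (\<lambda>a. blinfun_apply a x) - blinfun_apply y x)" for m v and i :: "'a option"
  \<comment> \<open>\<open>W\<close> records each measure by its barycenter error on
    \<open>X\<close> and by a bound \<open>v\<close> for its cost, relative to the level
    \<open>v0\<close> just above the envelope. The cap \<open>V\<close> keeps \<open>W\<close>
    bounded; the negated claim keeps it away from the origin.\<close>
  define W where "W = {u m v | m v. m \<in> prob_on K \<and> expect m F \<le> v \<and> v \<le> V}"
  let ?I = "insert None (Some ` X)"
  have sum_I: "(\<Sum>i\<in>?I. f i) = f None + (\<Sum>x\<in>X. f (Some x))" for f :: "'a option \<Rightarrow> real"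
    using X by (subst sum.insert) (auto simp: sum.reindex)
  have "0 \<le> R" using R[OF y] norm_ge_zero order_trans by blast
  have ab: "\<bar>blinfun_apply a x\<bar> \<le> R * norm x" if "a \<in> K" for a x
    using norm_blinfun[of a x] R[OF that] by (smt (verit) mult_right_mono norm_ge_zero real_norm_def)
  have eb: "\<bar>expect m (\<lambda>a. blinfun_apply a x)\<bar> \<le> R * norm x" if "m \<in> prob_on K" for m x
  proof -
    have "expect m (\<lambda>a. blinfun_apply a x) \<le> expect m (\<lambda>_. R * norm x)"
      "expect m (\<lambda>_. - (R * norm x)) \<le> expect m (\<lambda>a. blinfun_apply a x)"
      using ab[of _ x] by (intro expect_mono[OF that]; force simp: abs_le_iff)+
    then show ?thesis by (simp add: expect_const[OF that] abs_le_iff)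
  qed
  have pm: "u (\<lambda>b. if b = a then 1 else 0) v \<in> W" if "a \<in> K" "F a \<le> v" "v \<le> V" for a v
    unfolding W_def using point_mass(1)[OF that(1)] point_mass(2)[OF that(1), of F] that(2,3)
    by (intro CollectI exI[of _ "\<lambda>b. if b = a then 1 else 0"] exI[of _ v]) simp
  have "F y \<le> V" using M[OF y] by (simp add: V_def)
  define B where "B = 2 * R * (\<Sum>x\<in>X. norm x) + (M + V + \<bar>v0\<bar>)"
  have "\<exists>p. \<forall>w\<in>W. 0 < (\<Sum>i\<in>?I. p i * w i)"
  proof (rule convex_separation[where W=W and I="?I" and B=B and \<rho>="min (r\<^sup>2) ((s / 2)\<^sup>2)"])
    show "finite ?I" using X by simp
    show "W \<noteq> {}" using pm[OF y] \<open>F y \<le> V\<close> by blast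
    show "0 < min (r\<^sup>2) ((s / 2)\<^sup>2)" using r s by simp
  next
    fix w w' and t :: real assume w: "w \<in> W" "w' \<in> W" and t: "0 \<le> t" "t \<le> 1"
    then obtain m v m' v' where m: "w = u m v" "m \<in> prob_on K" "expect m F \<le> v" "v \<le> V"
      and m': "w' = u m' v'" "m' \<in> prob_on K" "expect m' F \<le> v'" "v' \<le> V"
      unfolding W_def by blast
    note mix = prob_mixture[OF m(2) m'(2) t]
    have "(\<lambda>i. (1 - t) * w i + t * w' i) = u (\<lambda>a. (1 - t) * m a + t * m' a) ((1 - t) * v + t * v')"
    proof
      fix i
      show "(1 - t) * w i + t * w' i = u (\<lambda>a. (1 - t) * m a + t * m' a) ((1 - t) * v + t * v') i"
        by (cases i) (simp_all add: u_def m(1) m'(1) mix(2), simp_all add: algebra_simps)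
    qed
    moreover have "(1 - t) * expect m F + t * expect m' F \<le> (1 - t) * v + t * v'"
      using m(3) m'(3) t by (intro add_mono mult_left_mono) auto
    moreover have "(1 - t) * v + t * v' \<le> V"
      using m(4) m'(4) t convex_bound_le[of v V v' "1 - t" t] by simp
    ultimately show "(\<lambda>i. (1 - t) * w i + t * w' i) \<in> W"
      unfolding W_def using mix
      by (intro CollectI exI[of _ "\<lambda>a. (1 - t) * m a + t * m' a"] exI[of _ "(1 - t) * v + t * v'"]) simp
  next
    fix w i assume "w \<in> W" and i: "i \<in> ?I"
    then obtain m v where m: "w = u m v" "m \<in> prob_on K" "expect m F \<le> v" "v \<le> V"
      unfolding W_def by blast
    have nn: "0 \<le> 2 * R * (\<Sum>x\<in>X. norm x)" using \<open>0 \<le> R\<close> by (simp add: sum_nonneg)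
    have "- M \<le> expect m F"
      using expect_mono[OF m(2), of "\<lambda>_. - M" F] M expect_const[OF m(2)] by (force simp: abs_le_iff)
    moreover have "0 \<le> M" using M[OF y] by simp
    moreover have "M \<le> V" by (simp add: V_def)
    ultimately have v: "\<bar>v - v0\<bar> \<le> M + V + \<bar>v0\<bar>" "0 \<le> M + V + \<bar>v0\<bar>" using m(3,4) by linarith+
    show "\<bar>w i\<bar> \<le> B"
    proof (cases i)
      case None
      then show ?thesis using v nn by (simp add: m(1) u_def B_def)
    next
      case (Some x)
      then have "x \<in> X" using i by auto
      then have "norm x \<le> (\<Sum>x\<in>X. norm x)" using X by (intro member_le_sum) auto
      then have "2 * R * norm x \<le> 2 * R * (\<Sum>x\<in>X. norm x)" using \<open>0 \<le> R\<close> by (intro mult_left_mono) auto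
      moreover have "\<bar>expect m (\<lambda>a. blinfun_apply a x) - blinfun_apply y x\<bar> \<le> 2 * R * norm x"
        using eb[OF m(2), of x] ab[OF y, of x] by linarith
      ultimately show ?thesis using Some v by (simp add: m(1) u_def B_def)
    qed
  next
    fix w assume "w \<in> W"
    then obtain m v where m: "w = u m v" "m \<in> prob_on K" "expect m F \<le> v" "v \<le> V"
      unfolding W_def by blast
    have sq: "(w i)\<^sup>2 \<le> (\<Sum>i\<in>?I. (w i)\<^sup>2)" if "i \<in> ?I" for i
      using that X by (intro member_le_sum) auto
    consider x where "x \<in> X" "r \<le> \<bar>expect m (\<lambda>a. blinfun_apply a x) - blinfun_apply y x\<bar>"
      | "envelope K F y + s < expect m F"
      using contra m(2) by (force simp: not_less not_le)
    then show "min (r\<^sup>2) ((s / 2)\<^sup>2) \<le> (\<Sum>i\<in>?I. (w i)\<^sup>2)"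
    proof cases
      case 1
      then have "r\<^sup>2 \<le> (w (Some x))\<^sup>2"
        using r by (simp add: m(1) u_def abs_le_square_iff[symmetric])
      with sq[of "Some x"] 1 show ?thesis by auto
    next
      case 2
      then have "s / 2 \<le> w None" using m(3) by (simp add: m(1) u_def v0_def)
      then have "(s / 2)\<^sup>2 \<le> (w None)\<^sup>2" using s by (intro power_mono) auto
      with sq[of None] show ?thesis by auto
    qed
  qed
  then obtain p where p: "\<And>w. w \<in> W \<Longrightarrow> 0 < (\<Sum>i\<in>?I. p i * w i)"
    by blast
  \<comment> \<open>For the point mass at \<open>y\<close> the coordinates in \<open>X\<close>
    vanish, so the separating functional has a positive cost coefficient.\<close>
  have "0 < p None * (V - v0)"
    using p[OF pm[OF y \<open>F y \<le> V\<close> order_refl]] unfolding sum_I by (simp add: u_def point_mass[OF y])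
  then have p0: "0 < p None" by (simp add: V_def zero_less_mult_iff)
  define w where "w = - (\<Sum>x\<in>X. (p (Some x) / p None) *\<^sub>R x)"
  \<comment> \<open>Dividing by \<open>p None\<close> gives an affine minorant whose value at
    \<open>y\<close> is \<open>v0\<close>, above the envelope.\<close>
  have "(w, v0 - blinfun_apply y w) \<in> minorants K F"
    unfolding minorants_def
  proof safe
    fix a assume a: "a \<in> K"
    have "F a \<le> V" using M[OF a] by (simp add: V_def)
    from p[OF pm[OF a order_refl this]]
    have "0 < p None * (F a - v0) + (\<Sum>x\<in>X. p (Some x) * (blinfun_apply a x - blinfun_apply y x))"
      unfolding sum_I by (simp add: u_def point_mass[OF a])
    also have "(\<Sum>x\<in>X. p (Some x) * (blinfun_apply a x - blinfun_apply y x))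
        = - (p None * (blinfun_apply a w - blinfun_apply y w))"
      using p0 by (simp add: w_def blinfun.minus_right blinfun.sum_right blinfun.scaleR_right
          sum_distrib_left right_diff_distrib sum_subtractf)
    finally have "0 < p None * (F a - v0 - (blinfun_apply a w - blinfun_apply y w))"
      by (simp add: algebra_simps)
    then show "blinfun_apply a w + (v0 - blinfun_apply y w) \<le> F a"
      using p0 by (simp add: zero_less_mult_iff)
  qed
  from minorant_le_envelope[OF this y] show False using s by (simp add: v0_def)
qed

text \<open>The convexifiability of the Kuratowski measure: the convex hull of finitely many balls is a
  norm-compact set plus a ball of the same radius.\<close>

lemma barycenters_covered:
  fixes K :: "'a :: real_normed_vector dual set"
  assumes R: "\<And>a. a \<in> K \<Longrightarrow> norm a \<le> R" and T: "kuratowski T < ereal e" and e': "e + 2 * R * \<eta> \<le> e'"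
    and "0 \<le> R" "0 \<le> \<eta>"
    and Y: "\<And>y X r. y \<in> Y \<Longrightarrow> finite X \<Longrightarrow> 0 < r \<Longrightarrow>
      \<exists>m\<in>prob_on K. (\<forall>x\<in>X. \<bar>expect m (\<lambda>a. blinfun_apply a x) - blinfun_apply y x\<bar> < r)
        \<and> expect m (indicator (- T)) \<le> \<eta>"
  shows "kuratowski Y < ereal e'"
proof -
  obtain d C where d: "0 < d" "d < e" and C: "finite C" "T \<subseteq> (\<Union>c\<in>C. cball c (d / 2))"
    using T unfolding kuratowski_less_iff by blast
  define \<delta> where "\<delta> = (e - d) / 4"
  have "0 < \<delta>" using d by (simp add: \<delta>_def)
  have "compact (convex hull (insert 0 C))"
    using C(1) by (intro finite_imp_compact_convex_hull) simp
  then obtain N where N: "finite N" "convex hull (insert 0 C) \<subseteq> (\<Union>p\<in>N. ball p \<delta>)"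
    using seq_compact_imp_totally_bounded[of "convex hull (insert 0 C)"] \<open>0 < \<delta>\<close>
    unfolding compact_eq_seq_compact_metric by blast
  \<comment> \<open>The summands are the ball radius, the error from the mass outside
    \<open>T\<close>, and the error of the finite net \<open>N\<close>.\<close>
  define \<rho> where "\<rho> = d / 2 + R * \<eta> + \<delta>"
  have "Y \<subseteq> (\<Union>p\<in>N. cball p \<rho>)"
  proof
    fix y assume y: "y \<in> Y"
    \<comment> \<open>A finite union of balls is weak-star closed, so it suffices that the
      barycenters approximating \<open>y\<close> lie in it.\<close>
    have "closedin weak_star (\<Union>p\<in>N. cball p \<rho>)"
      using N(1) by (intro closedin_Union) (auto simp: closedin_weak_star_cball)
    moreover have "y \<in> weak_star closure_of (\<Union>p\<in>N. cball p \<rho>)"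
      unfolding in_weak_star_closure_iff
    proof (intro allI impI, elim conjE)
      fix X :: "'a set" and r :: real assume "finite X" "0 < r"
      from Y[OF y this] obtain m where m: "m \<in> prob_on K" and near:
        "\<forall>x\<in>X. \<bar>expect m (\<lambda>a. blinfun_apply a x) - blinfun_apply y x\<bar> < r"
        and \<eta>: "expect m (indicator (- T)) \<le> \<eta>" by blast
      define S where "S = {a. m a \<noteq> 0}"
      have S: "finite S" "S \<subseteq> K" "\<And>a. 0 \<le> m a" "sum m S = 1"
        using m by (auto simp: prob_on_def S_def)
      \<comment> \<open>A point outside \<open>T\<close> is approximated by \<open>0\<close> with
        error at most \<open>R\<close>; this is why \<open>0\<close> joins the centres.\<close>
      have "\<exists>c\<in>insert 0 C. norm (a - c) \<le> d / 2 + R * indicator (- T) a" if "a \<in> S" for a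
      proof (cases "a \<in> T")
        case True
        with C(2) show ?thesis by (force simp: dist_norm norm_minus_commute)
      next
        case False
        then show ?thesis using R[of a] S(2) that d by auto
      qed
      then obtain c where c: "\<And>a. a \<in> S \<Longrightarrow> c a \<in> insert 0 C"
        "\<And>a. a \<in> S \<Longrightarrow> norm (a - c a) \<le> d / 2 + R * indicator (- T) a" by metis
      define b where "b = (\<Sum>a\<in>S. m a *\<^sub>R a)"
      define q where "q = (\<Sum>a\<in>S. m a *\<^sub>R c a)"
      have "q \<in> convex hull (insert 0 C)"
        unfolding q_def using S c(1) by (intro convex_sum) (auto intro: hull_inc)
      then obtain p where p: "p \<in> N" "dist p q < \<delta>" using N(2) by auto
      have "norm (b - q) = norm (\<Sum>a\<in>S. m a *\<^sub>R (a - c a))"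
        by (simp add: b_def q_def sum_subtractf scaleR_diff_right)
      also have "\<dots> \<le> (\<Sum>a\<in>S. m a * (d / 2 + R * indicator (- T) a))"
        using S(3) c(2) by (intro sum_norm_le) (simp add: mult_left_mono)
      also have "\<dots> = expect m (\<lambda>a. d / 2 + R * indicator (- T) a)"
        by (simp add: expect_def S_def)
      also have "\<dots> = d / 2 + R * expect m (indicator (- T))"
        by (simp add: expect_add expect_const[OF m] expect_cmult)
      also have "\<dots> \<le> d / 2 + R * \<eta>" using \<eta> \<open>0 \<le> R\<close> by (simp add: mult_left_mono)
      finally have "dist p b \<le> \<rho>"
        using p(2) dist_triangle[of p b q] by (simp add: \<rho>_def dist_norm norm_minus_commute)
      moreover have "blinfun_apply b x = expect m (\<lambda>a. blinfun_apply a x)" for x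
        by (simp add: b_def expect_def S_def blinfun.sum_left blinfun.scaleR_left)
      then have "b \<in> wball y X r" using near by (simp add: wball_def)
      ultimately show "\<exists>z\<in>\<Union>p\<in>N. cball p \<rho>. z \<in> wball y X r"
        using p(1) by (intro bexI[of _ b]) auto
    qed
    ultimately show "y \<in> (\<Union>p\<in>N. cball p \<rho>)" by (simp add: closure_of_closedin)
  qed
  moreover have "0 < 2 * \<rho>" "2 * \<rho> < e'"
    using d e' \<open>0 \<le> R\<close> \<open>0 \<le> \<eta>\<close> \<open>0 < \<delta>\<close>
    by (auto simp: \<rho>_def \<delta>_def field_simps intro!: add_pos_nonneg)
  ultimately show ?thesis
    unfolding kuratowski_less_iff using N(1) by (intro exI[of _ "2 * \<rho>"] exI[of _ N]) simp
qed

lemma convex_iter_subset: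
  fixes a :: "('s + nat) ordinal"
  assumes "closedin weak_star A" "convex A"
  shows "convex_iter e A a \<subseteq> A"
  using convex_iter_antimono[OF assms zero_ordinal_least[of a], of e] by (simp add: trans_iter_zero)

subsection \<open>Convex derivations of slices\<close>

text \<open>Every point of \<open>T\<close> has a neighbourhood of small measure; finitely many
  cover \<open>T\<close>, and the bound survives finite unions.\<close>

lemma kuratowski_less_of_sigma_deriv_empty:
  assumes T: "compactin weak_star T" and e: "0 < e" and empty: "sigma_deriv e T = {}"
  shows "kuratowski T < ereal e"
proof -
  let ?\<U> = "{U. openin weak_star U \<and> kuratowski (T \<inter> U) < ereal e}"
  have "T \<subseteq> \<Union>?\<U>"
  proof
    fix y assume "y \<in> T"
    moreover have "y \<notin> sigma_deriv e T" using empty by simp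
    ultimately show "y \<in> \<Union>?\<U>" unfolding sigma_deriv_iff by (auto simp: not_le)
  qed
  then obtain \<F> where \<F>: "finite \<F>" "\<F> \<subseteq> ?\<U>" "T \<subseteq> \<Union>\<F>"
    using T unfolding compactin_def by (metis (no_types, lifting) mem_Collect_eq)
  have "kuratowski (\<Union>U\<in>\<F>. T \<inter> U) < ereal e"
    using \<F>(1,2)
  proof (induction \<F> rule: finite_induct)
    case empty
    show ?case using kuratowski_empty[OF e] by simp
  next
    case (insert U \<F>)
    then show ?case using kuratowski_Un[of "T \<inter> U" e "\<Union>U\<in>\<F>. T \<inter> U"] by simp
  qed
  moreover have "(\<Union>U\<in>\<F>. T \<inter> U) = T" using \<F>(3) by blast
  ultimately show ?thesis by simp
qed

text \<open>The open half-space above level \<open>c\<close> is a neighbourhood of its points, so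
  none of them survives. The complementary half-space is convex and weak-star closed, hence absorbs
  the closed convex hull.\<close>

lemma convex_sigma_deriv_le:
  assumes "kuratowski {y \<in> L. c \<le> blinfun_apply y x} < ereal e"
  shows "convex_sigma_deriv e L \<subseteq> {y. blinfun_apply y x \<le> c}"
proof -
  have "sigma_deriv e L \<subseteq> {y. blinfun_apply y x \<le> c}"
  proof (rule subsetI, rule CollectI, rule ccontr)
    fix y assume y: "y \<in> sigma_deriv e L" and "\<not> blinfun_apply y x \<le> c"
    let ?U = "UNIV - {z. blinfun_apply z x \<le> c}"
    have "openin weak_star ?U"
      using openin_diff[OF openin_topspace closedin_weak_star_le] strong_operator_topology_topspace by metis
    moreover have "y \<in> ?U" using \<open>\<not> blinfun_apply y x \<le> c\<close> by simp
    ultimately have "ereal e \<le> kuratowski (L \<inter> ?U)"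
      using y by (auto simp: sigma_deriv_iff)
    also have "\<dots> \<le> kuratowski {y \<in> L. c \<le> blinfun_apply y x}"
      by (rule kuratowski_mono) auto
    finally show False using assms by simp
  qed
  moreover have "convex {y. blinfun_apply y x \<le> c}"
  proof (rule convexI)
    fix y z :: "'a dual" and u v :: real
    assume "y \<in> {y. blinfun_apply y x \<le> c}" "z \<in> {y. blinfun_apply y x \<le> c}" "0 \<le> u" "0 \<le> v" "u + v = 1"
    then show "u *\<^sub>R y + v *\<^sub>R z \<in> {y. blinfun_apply y x \<le> c}"
      using convex_bound_le[of "blinfun_apply y x" c "blinfun_apply z x" u v]
      by (simp add: blinfun.add_left blinfun.scaleR_left)
  qed
  ultimately have "convex hull (sigma_deriv e L) \<subseteq> {y. blinfun_apply y x \<le> c}"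
    by (rule hull_minimal)
  then show ?thesis
    unfolding convex_sigma_deriv_def by (rule closure_of_minimal[OF _ closedin_weak_star_le])
qed

text \<open>Lower semicontinuity is demanded of \<open>F\<close> plus every evaluation functional,
  so that it passes to tilted costs at once.\<close>

definition lsc_on :: "'a :: real_normed_vector dual set \<Rightarrow> ('a dual \<Rightarrow> real) \<Rightarrow> bool" where
  "lsc_on K F \<longleftrightarrow> (\<forall>x c. closedin weak_star {z \<in> K. F z + blinfun_apply z x \<le> c})"

text \<open>Measure-free form of: every representing measure of \<open>y\<close> that is almost optimal for the cost
  \<open>F\<close> is carried by \<open>T\<close> up to mass \<open>\<eta>\<close>.\<close>

definition carried ::
    "'a :: real_normed_vector dual set \<Rightarrow> ('a dual \<Rightarrow> real) \<Rightarrow> 'a dual set \<Rightarrow> real \<Rightarrow> real \<Rightarrow> 'a dual \<Rightarrow> bool" where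
  "carried K F T s \<eta> y \<longleftrightarrow> (\<exists>X r. finite X \<and> 0 < r \<and> (\<forall>m\<in>prob_on K.
     (\<forall>x\<in>X. \<bar>expect m (\<lambda>a. blinfun_apply a x) - blinfun_apply y x\<bar> < r) \<and>
     expect m F \<le> envelope K F y + s \<longrightarrow> expect m (indicator (- T)) \<le> \<eta>))"

section \<open>Layers of a carrier and the cost counting them\<close>

locale layers =
  fixes K T :: "'a :: real_normed_vector dual set" and G :: "'a dual \<Rightarrow> real"
    and e :: real and d :: "('s + nat) ordinal" and N :: nat and s :: real
  assumes closed_carrier: "closedin weak_star T" and carrier_subset: "T \<subseteq> K" and lsc_G: "lsc_on K G"
    and pos_e: "0 < e" and pos_s: "0 < s"
    and layer_N: "((\<lambda>B. szlenk_iter e B d) ^^ N) T = {}"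
begin

definition layer :: "nat \<Rightarrow> 'a dual set" where
  "layer k = ((\<lambda>B. szlenk_iter e B d) ^^ k) T"

text \<open>The number of blocks survived. Points outside \<open>T\<close> have rank 0, like those
  lost in the first block.\<close>

definition rank :: "'a dual \<Rightarrow> nat" where
  "rank z = (LEAST k. z \<notin> layer (Suc k))"

definition cost :: "'a dual \<Rightarrow> real" where
  "cost z = G z - s * real (rank z)"

lemma layer_Suc: "layer (Suc k) = szlenk_iter e (layer k) d"
  by (simp add: layer_def)

lemma layer_Suc_subset: "layer (Suc k) \<subseteq> layer k"
  by (simp add: layer_Suc szlenk_iter_subset)

lemma layer_antimono: "j \<le> k \<Longrightarrow> layer k \<subseteq> layer j"
  by (rule lift_Suc_antimono_le[of layer, OF layer_Suc_subset])

lemma closedin_layer: "closedin weak_star (layer k)"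
  by (induction k) (use closed_carrier in \<open>simp add: layer_def\<close>, simp add: layer_Suc closedin_szlenk_iter)

lemma rank_le: "rank z \<le> N"
  unfolding rank_def using layer_N layer_Suc_subset[of N] by (intro Least_le) (auto simp: layer_def)

lemma in_layer_Suc_iff: "z \<in> layer (Suc k) \<longleftrightarrow> k < rank z"
proof
  have "z \<notin> layer (Suc N)" using layer_N layer_Suc_subset[of N] by (auto simp: layer_def)
  then have "z \<notin> layer (Suc (rank z))" unfolding rank_def by (rule LeastI)
  then show "k < rank z" if "z \<in> layer (Suc k)"
    using that layer_antimono[of "Suc (rank z)" "Suc k"] by (meson Suc_le_mono not_le subsetD)
  show "z \<in> layer (Suc k)" if "k < rank z"
    using not_less_Least[of k "\<lambda>k. z \<notin> layer (Suc k)"] that by (simp add: rank_def)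
qed

lemma in_layer_rank: "z \<in> T \<Longrightarrow> z \<in> layer (rank z)"
  using in_layer_Suc_iff[of z "rank z - 1"] by (cases "rank z") (auto simp: layer_def)

lemma in_layer_rank_le: "z \<in> layer k \<Longrightarrow> k \<le> rank z"
  using in_layer_Suc_iff[of z "k - 1"] by (cases k) auto

text \<open>Layers are closed and a deeper layer only lowers the cost, so a sublevel set is a finite
  union of closed pieces, one for each rank. For rank 0 no layer is imposed, since points outside
  \<open>T\<close> have that rank as well.\<close>

lemma lsc_cost: "lsc_on K cost"
  unfolding lsc_on_def
proof (intro allI)
  fix x c
  let ?S = "\<lambda>j. {z \<in> K. G z + blinfun_apply z x \<le> c + s * real j}"
  have "{z \<in> K. cost z + blinfun_apply z x \<le> c} = (\<Union>j\<in>{..N}. ?S j \<inter> (if j = 0 then ?S j else layer j))"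
    (is "?A = ?B")
  proof (intro equalityI subsetI)
    fix z assume z: "z \<in> ?A"
    then have "z \<in> layer (rank z)" if "rank z \<noteq> 0"
      using that in_layer_Suc_iff[of z "rank z - 1"] by auto
    then show "z \<in> ?B"
      using z rank_le[of z] by (intro UN_I[of "rank z"]) (auto simp: cost_def)
  next
    fix z assume "z \<in> ?B"
    then obtain j where "z \<in> K" "G z + blinfun_apply z x \<le> c + s * real j" "j = 0 \<or> z \<in> layer j"
      by (auto split: if_splits)
    moreover from this have "j \<le> rank z" using in_layer_rank_le by auto
    then have "s * real j \<le> s * real (rank z)" using pos_s by simp
    ultimately show "z \<in> ?A" by (simp add: cost_def)
  qed
  moreover have "closedin weak_star ?B"
    using lsc_G closedin_layer by (intro closedin_Union) (auto simp: lsc_on_def)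
  ultimately show "closedin weak_star ?A" by simp
qed

text \<open>A slice of the graph of \<open>cost\<close> that is thinner than \<open>s\<close> meets each layer in a set that
  misses the next layer.\<close>

lemma szlenk_iter_thin_slice:
  assumes minor: "(x, k) \<in> minorants K cost" and q: "q < s"
  shows "szlenk_iter e {z \<in> T. cost z - (blinfun_apply z x + k) \<le> q} d = {}"
proof -
  define A where "A j = layer j \<inter> {z \<in> K. G z + blinfun_apply z (- x) \<le> q + k + s * real j}" for j
  have closed: "closedin weak_star (A j)" for j
    unfolding A_def using lsc_G closedin_layer by (intro closedin_Int) (auto simp: lsc_on_def)
  have empty: "szlenk_iter e (A j) d = {}" for j
  proof -
    have "szlenk_iter e (A j) d \<subseteq> layer (Suc j)"
      unfolding layer_Suc by (rule trans_iter_mono) (auto simp: A_def intro: sigma_deriv_mono[THEN subsetD])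
    moreover have "szlenk_iter e (A j) d \<subseteq> A j" by (rule szlenk_iter_subset)
    \<comment> \<open>A point of the next layer has rank at least \<open>j + 1\<close>, which would
      put its cost at most \<open>q - s < 0\<close> above the minorant.\<close>
    moreover have "z \<notin> A j" if z: "z \<in> layer (Suc j)" for z
    proof
      assume "z \<in> A j"
      then have "z \<in> K" "G z \<le> blinfun_apply z x + q + k + s * real j"
        by (auto simp: A_def blinfun.minus_right)
      moreover have "s * real (Suc j) \<le> s * real (rank z)"
        using in_layer_rank_le[OF z] pos_s by simp
      ultimately show False
        using minor q by (force simp: minorants_def cost_def algebra_simps)
    qed
    ultimately show ?thesis by blast
  qed
  have "{z \<in> T. cost z - (blinfun_apply z x + k) \<le> q} \<subseteq> (\<Union>j\<in>{..N}. A j)"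
  proof
    fix z assume z: "z \<in> {z \<in> T. cost z - (blinfun_apply z x + k) \<le> q}"
    then have "z \<in> A (rank z)"
      using in_layer_rank[of z] carrier_subset by (auto simp: A_def cost_def blinfun.minus_right)
    then show "z \<in> (\<Union>j\<in>{..N}. A j)" using rank_le[of z] by auto
  qed
  then have "szlenk_iter e {z \<in> T. cost z - (blinfun_apply z x + k) \<le> q} d \<subseteq> szlenk_iter e (\<Union>j\<in>{..N}. A j) d"
    by (intro trans_iter_mono) (auto intro: sigma_deriv_mono[THEN subsetD])
  then show ?thesis
    using szlenk_iter_UN_empty[of "{..N}" e A d] pos_e closed empty by simp
qed

end

text \<open>The slice is never derived itself: \<open>L\<close> is any closed convex set, and the
  slice enters only through \<open>carried\<close>. The induction hypothesis thus applies with a new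
  cost, carrier and direction. For \<open>g = 1\<close> the slice consists of approximate
  barycenters of measures almost on \<open>T\<close>; for a limit \<open>g\<close>, blocks of
  \<open>d\<close> convex derivations lower all minorants of a tilted cost.\<close>

lemma convex_iter_slice:
  fixes g :: "('s + nat) ordinal" and K :: "'a :: real_normed_vector dual set"
  assumes g: "indecomposable g" and R: "\<And>a. a \<in> K \<Longrightarrow> norm a \<le> R" "0 \<le> R" and e: "0 < e"
    and F: "lsc_on K F" "\<And>a. a \<in> K \<Longrightarrow> \<bar>F a\<bar> \<le> M"
    and T: "compactin weak_star T" "T \<subseteq> K" "szlenk_iter e T g = {}"
    and L: "closedin weak_star L" "convex L" "L \<subseteq> K"
    and s: "0 < s" and \<eta>: "0 \<le> \<eta>" "e + 2 * R * \<eta> < e'"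
    and carr: "\<And>y. y \<in> L \<Longrightarrow> c \<le> blinfun_apply y x0 \<Longrightarrow> carried K F T s \<eta> y"
  shows "convex_iter e' L g \<subseteq> {y. blinfun_apply y x0 \<le> c}"
  using g F T L s \<eta> carr
proof (induction g arbitrary: F M T L x0 c s \<eta> rule: less_induct)
  case (less g)
  note F = less.prems(2,3) and T = less.prems(4,5,6) and L = less.prems(7,8,9) and s = less.prems(10)
    and \<eta> = less.prems(11,12) and carr = less.prems(13)
  from less.prems(1) consider "g = 1" | "is_limit g" by (rule indecomposable_cases)
  then show ?case
  proof cases
    case 1
    then have g: "g = succ 0" by (simp add: ordinal_arithmetic)
    have kur: "kuratowski T < ereal e"
      using T(3) by (intro kuratowski_less_of_sigma_deriv_empty T(1) e) (simp add: g trans_iter_succ trans_iter_zero)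
    have near: "\<exists>m\<in>prob_on K. (\<forall>x\<in>X. \<bar>expect m (\<lambda>a. blinfun_apply a x) - blinfun_apply y x\<bar> < r)
        \<and> expect m (indicator (- T)) \<le> \<eta>"
      if y: "y \<in> {y \<in> L. c \<le> blinfun_apply y x0}" and X: "finite X" "0 < r" for y X r
    proof -
      obtain X0 r0 where X0: "finite X0" "0 < r0" and c: "\<And>m. m \<in> prob_on K \<Longrightarrow>
          (\<forall>x\<in>X0. \<bar>expect m (\<lambda>a. blinfun_apply a x) - blinfun_apply y x\<bar> < r0) \<Longrightarrow>
          expect m F \<le> envelope K F y + s \<Longrightarrow> expect m (indicator (- T)) \<le> \<eta>"
        using carr[of y] y unfolding carried_def by blast
      have "y \<in> K" using y L(3) by auto
      then obtain m where m: "m \<in> prob_on K" "expect m F \<le> envelope K F y + s"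
        "\<And>x. x \<in> X \<union> X0 \<Longrightarrow> \<bar>expect m (\<lambda>a. blinfun_apply a x) - blinfun_apply y x\<bar> < min r r0"
        using envelope_attained[of K R F M y "X \<union> X0" "min r r0" s] R(1) F(2) X X0 s by auto
      then show ?thesis using c[of m] by (intro bexI[of _ m]) auto
    qed
    have "kuratowski {y \<in> L. c \<le> blinfun_apply y x0} < ereal e'"
      by (rule barycenters_covered[OF R(1) kur less_imp_le[OF \<eta>(2)] R(2) \<eta>(1) near])
    then show ?thesis
      by (simp add: g trans_iter_succ trans_iter_zero convex_sigma_deriv_le)
  next
    case 2
    \<comment> \<open>Compactness moves the empty stage below the limit; \<open>b\<close> is then
      raised to be positive, as the splitting into blocks requires.\<close>
    obtain b0 where "b0 < g" "szlenk_iter e T b0 = {}"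
      using szlenk_iter_limit_empty[OF T(1) 2 T(3)] by blast
    then obtain b where b: "b < g" "0 < b" "szlenk_iter e T b = {}"
      using 2 szlenk_iter_antimono[of b0 _ e T] zero_ordinal_least unfolding is_limit_def
      by (metis le_less_trans less_imp_le subset_empty)
    obtain d N where d: "indecomposable d" "d \<le> b"
      and N: "\<And>A :: 'a dual set. ((\<lambda>B. szlenk_iter e B d) ^^ N) A \<subseteq> szlenk_iter e A b"
      using iterate_indecomposable_le[OF sigma_deriv_mono[OF _ order_refl] sigma_deriv_subset b(2)]
      by blast
    have N: "((\<lambda>B. szlenk_iter e B d) ^^ N) T = {}" using N[of T] b(3) by simp
    have "d < g" using d b by simp
    note IH = less.IH[OF \<open>d < g\<close> d(1)]
    show ?thesis
    proof (rule subsetI, rule CollectI, rule ccontr)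
      fix y1 assume y1: "y1 \<in> convex_iter e' L g" and "\<not> blinfun_apply y1 x0 \<le> c"
      then have \<beta>: "0 < blinfun_apply y1 x0 - c" by simp
      have "y1 \<in> L" using y1 convex_iter_subset[OF L(1,2), of e' g] by blast
      then have "0 \<le> M" using F(2)[of y1] L(3) by force
      \<comment> \<open>The rank term stays below \<open>s / 4\<close>, so near-optimality for the
        new cost implies optimality for \<open>F\<close> up to \<open>s\<close>.\<close>
      define s' where "s' = s / (4 * (real N + 1))"
      have s': "0 < s'" "s' * real N \<le> s / 4" "s' \<le> s / 4"
        using s by (auto simp: s'_def field_simps)
      \<comment> \<open>The tilt gains more between level \<open>c\<close> and \<open>y1\<close>
        than the bounds on \<open>F\<close> and on the rank term can absorb; this gives the final
        contradiction.\<close>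
      define r where "r = (2 * M + s' * real N + 1) / (blinfun_apply y1 x0 - c)"
      have r: "0 < r" "r * (blinfun_apply y1 x0 - c) = 2 * M + s' * real N + 1"
        using \<beta> \<open>0 \<le> M\<close> s' by (auto simp: r_def intro!: divide_pos_pos add_nonneg_pos)
      \<comment> \<open>\<open>q\<close> is both the thickness of a slice and the mass lost in
        Markov's inequality: \<open>q < s'\<close> suits \<open>szlenk_iter_thin_slice\<close>, and
        the last bound keeps \<open>e + 2 * R * (\<eta> + q) < e'\<close>.\<close>
      define q where "q = min (min 1 (s' / 2)) ((e' - e - 2 * R * \<eta>) / (4 * (R + 1)))"
      have gap: "0 < e' - e - 2 * R * \<eta>" using \<eta> by simp
      have "q \<le> min 1 (s' / 2)" unfolding q_def by (rule min.cobounded1)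
      then have "q \<le> s' / 2" "q \<le> 1" by simp_all
      moreover have "0 < q" unfolding q_def using s' gap R(2) by simp
      ultimately have q: "0 < q" "q \<le> 1" "q < s'" "q \<le> s / 8"
        using s' by linarith+
      have "2 * R * q \<le> 2 * R * ((e' - e - 2 * R * \<eta>) / (4 * (R + 1)))"
        using R(2) by (intro mult_left_mono) (auto simp: q_def)
      also have "\<dots> = (e' - e - 2 * R * \<eta>) * (2 * R / (4 * (R + 1)))" by simp
      also have "\<dots> < (e' - e - 2 * R * \<eta>) * 1"
        using R(2) by (intro mult_strict_left_mono gap) (simp add: field_simps)
      finally have q': "e + 2 * R * (\<eta> + q) < e'" by (simp add: algebra_simps)
      define \<delta> where "\<delta> = q\<^sup>2 / 3"
      have "q\<^sup>2 \<le> q" using q by (simp add: power2_eq_square mult_left_le)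
      then have "\<delta> \<le> s / 8" using q s unfolding \<delta>_def by linarith
      then have \<delta>: "0 < \<delta>" "\<delta> \<le> s / 8" "3 * \<delta> = q * q"
        using q(1) by (auto simp: \<delta>_def power2_eq_square)
      define G where "G z = F z + r * blinfun_apply z x0" for z
      have lscG: "lsc_on K G"
        unfolding lsc_on_def
      proof (intro allI)
        fix x c
        have "closedin weak_star {z \<in> K. F z + blinfun_apply z (x + r *\<^sub>R x0) \<le> c}"
          using F(1) by (simp add: lsc_on_def)
        then show "closedin weak_star {z \<in> K. G z + blinfun_apply z x \<le> c}"
          by (simp add: G_def blinfun.add_right blinfun.scaleR_right add.assoc add.commute add.left_commute)
      qed
      interpret layers K T G e d N s'
        by unfold_locales
          (use T(2) lscG e s' N compactin_imp_closedin[OF Hausdorff_space_weak_star T(1)] in auto)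
      have rank: "0 \<le> s' * real (rank z)" "s' * real (rank z) \<le> s' * real N" for z
        using s'(1) rank_le[of z] by auto
      have ab: "\<bar>blinfun_apply a x0\<bar> \<le> R * norm x0" if "a \<in> K" for a
        using norm_blinfun[of a x0] R(1)[OF that] by (smt (verit) mult_right_mono norm_ge_zero real_norm_def)
      have rab: "\<bar>r * blinfun_apply a x0\<bar> \<le> r * (R * norm x0)" if "a \<in> K" for a
        using ab[OF that] r(1) by (simp add: abs_mult)
      define M2 where "M2 = M + r * (R * norm x0) + s' * real N"
      have cost_bound: "\<bar>cost a\<bar> \<le> M2" if "a \<in> K" for a
        using F(2)[OF that] rab[OF that] rank[of a] unfolding cost_def G_def M2_def by linarith
      have cost_le: "cost a \<le> M + r * blinfun_apply a x0" if "a \<in> K" for a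
        using F(2)[OF that] rank[of a] unfolding cost_def G_def by linarith
      \<comment> \<open>The bound descends by \<open>\<delta>\<close> per block down to the floor
        \<open>M + r * c\<close>, below which \<open>carr\<close> says nothing.\<close>
      define \<tau> where "\<tau> j = max (M + r * c) (M + r * (R * norm x0) - real j * \<delta>)" for j :: nat
      define Lj where "Lj j = ((\<lambda>B. convex_iter e' B d) ^^ j) L" for j
      have Lj: "\<exists>b<g. Lj j = convex_iter e' L b" for j
        unfolding Lj_def by (rule trans_iter_le_iterate[OF convex_iter_decreasing[OF L(1,2)] less.prems(1) \<open>d < g\<close>])
      have Lj_props: "closedin weak_star (Lj j)" "convex (Lj j)" "Lj j \<subseteq> L" for j
      proof -
        obtain b :: "('s + nat) ordinal" where b: "Lj j = convex_iter e' L b" using Lj by blast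
        show "closedin weak_star (Lj j)" "convex (Lj j)" "Lj j \<subseteq> L"
          using closed_convex_iter[OF L(1,2), of e' b] convex_iter_subset[OF L(1,2), of e' b]
          unfolding b by blast+
      qed
      \<comment> \<open>All minorants are treated at once: lowering a single one uses that the whole
        envelope is at most \<open>\<tau> j\<close>.\<close>
      have main: "blinfun_apply y x + k \<le> \<tau> j" if "(x, k) \<in> minorants K cost" "y \<in> Lj j" for x k y j
        using that
      proof (induction j arbitrary: x k y)
        case 0
        then have "y \<in> K" using Lj_props(3) L(3) by blast
        then have "blinfun_apply y x + k \<le> cost y" using 0 by (auto simp: minorants_def)
        also have "\<dots> \<le> M + r * (R * norm x0)"
          using cost_le[OF \<open>y \<in> K\<close>] rab[OF \<open>y \<in> K\<close>] by linarith
        finally show ?case by (simp add: \<tau>_def)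
      next
        case (Suc j)
        define T' where "T' = {z \<in> T. cost z - (blinfun_apply z x + k) \<le> q}"
        have "T' = {z \<in> K. cost z + blinfun_apply z (- x) \<le> q + k} \<inter> T"
          using T(2) by (auto simp: T'_def blinfun.minus_right)
        then have T': "compactin weak_star T'"
          using closed_Int_compactin[OF _ T(1)] lsc_cost by (auto simp: lsc_on_def)
        have "carried K cost T' \<delta> (\<eta> + q) z"
          if z: "z \<in> Lj j" "\<tau> (Suc j) - k \<le> blinfun_apply z x" for z
        proof -
          have zK: "z \<in> K" "z \<in> L" using z Lj_props(3) L(3) by blast+
          \<comment> \<open>The floor of \<open>\<tau>\<close> puts the slice of the minorant inside
            the original slice, where \<open>carr\<close> applies.\<close>
          have "M + r * c \<le> M + r * blinfun_apply z x0"
            using z(2) cost_le[OF zK(1)] Suc.prems(1) zK(1) by (force simp: \<tau>_def minorants_def)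
          then have "c \<le> blinfun_apply z x0" using r(1) by simp
          from carr[OF zK(2) this] obtain X0 r0 where X0: "finite X0" "0 < r0"
            and c: "\<And>m. m \<in> prob_on K \<Longrightarrow>
              (\<forall>x\<in>X0. \<bar>expect m (\<lambda>a. blinfun_apply a x) - blinfun_apply z x\<bar> < r0) \<Longrightarrow>
              expect m F \<le> envelope K F z + s \<Longrightarrow> expect m (indicator (- T)) \<le> \<eta>"
            unfolding carried_def by blast
          have env_tau: "envelope K cost z \<le> \<tau> j"
            by (rule envelope_le[where M=M2]) (use Suc.IH z(1) cost_bound in \<open>force simp: abs_le_iff\<close>)+
          \<comment> \<open>Removing the tilt turns a minorant of \<open>cost\<close> into one of
            \<open>F\<close>, as ranks are nonnegative.\<close>
          have env_F: "envelope K cost z \<le> envelope K F z + r * blinfun_apply z x0"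
          proof (rule envelope_le[where M=M2])
            fix x' k' assume m: "(x', k') \<in> minorants K cost"
            have "(x' - r *\<^sub>R x0, k') \<in> minorants K F"
              unfolding minorants_def
            proof safe
              fix a assume "a \<in> K"
              then have "blinfun_apply a x' + k' \<le> cost a" using m by (auto simp: minorants_def)
              also have "\<dots> \<le> F a + r * blinfun_apply a x0"
                using rank[of a] by (simp add: cost_def G_def)
              finally show "blinfun_apply a (x' - r *\<^sub>R x0) + k' \<le> F a"
                by (simp add: blinfun.diff_right blinfun.scaleR_right)
            qed
            from minorant_le_envelope[OF this zK(1)]
            show "blinfun_apply z x' + k' \<le> envelope K F z + r * blinfun_apply z x0"
              by (simp add: blinfun.diff_right blinfun.scaleR_right)
          qed (use cost_bound in \<open>force simp: abs_le_iff\<close>)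
          show ?thesis
            unfolding carried_def
          proof (intro exI conjI ballI impI; (elim conjE)?)
            \<comment> \<open>\<open>X0\<close> serves the old carrier, \<open>x0\<close> controls
              the tilt and \<open>x\<close> the minorant.\<close>
            show "finite (X0 \<union> {x0, x})" "0 < min r0 (min (s / (8 * r)) \<delta>)"
              using X0 s r(1) \<delta>(1) by auto
            fix m assume m: "m \<in> prob_on K"
              and near: "\<forall>x\<in>X0 \<union> {x0, x}. \<bar>expect m (\<lambda>a. blinfun_apply a x) - blinfun_apply z x\<bar>
                < min r0 (min (s / (8 * r)) \<delta>)"
              and opt: "expect m cost \<le> envelope K cost z + \<delta>"
            have cost_eq: "expect m cost = expect m F + r * expect m (\<lambda>a. blinfun_apply a x0)
                - s' * expect m (\<lambda>a. real (rank a))"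
            proof -
              have "cost = (\<lambda>a. F a + r * blinfun_apply a x0 - s' * real (rank a))"
                by (simp add: fun_eq_iff cost_def G_def)
              then show ?thesis by (simp only: expect_add expect_diff expect_cmult)
            qed
            have rk: "s' * expect m (\<lambda>a. real (rank a)) \<le> s / 4"
            proof -
              have "expect m (\<lambda>a. real (rank a)) \<le> expect m (\<lambda>_. real N)"
                by (rule expect_mono[OF m]) (simp add: rank_le)
              then have "s' * expect m (\<lambda>a. real (rank a)) \<le> s' * real N"
                using s'(1) by (simp add: expect_const[OF m])
              with s'(2) show ?thesis by simp
            qed
            have "r * \<bar>expect m (\<lambda>a. blinfun_apply a x0) - blinfun_apply z x0\<bar> \<le> r * (s / (8 * r))"
              using near r(1) by (intro mult_left_mono) auto
            then have "\<bar>r * expect m (\<lambda>a. blinfun_apply a x0) - r * blinfun_apply z x0\<bar> \<le> s / 8"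
              using r(1) by (simp add: abs_mult flip: right_diff_distrib)
            then have "expect m F \<le> envelope K F z + s"
              using cost_eq rk opt env_F \<delta>(2) s by linarith
            then have eta: "expect m (indicator (- T)) \<le> \<eta>"
              using c[OF m] near by auto
            define D where "D a = cost a - (blinfun_apply a x + k)" for a
            have "expect m D = expect m cost - (expect m (\<lambda>a. blinfun_apply a x) + k)"
              unfolding D_def by (simp add: expect_diff expect_add expect_const[OF m])
            also have "\<dots> \<le> 3 * \<delta>"
            proof -
              \<comment> \<open>One \<open>\<delta>\<close> each comes from the drop of
                \<open>\<tau>\<close>, from the neighbourhood and from near-optimality.\<close>
              have "\<tau> j \<le> \<tau> (Suc j) + \<delta>" using \<delta>(1) by (auto simp: \<tau>_def algebra_simps)
              moreover have "\<bar>expect m (\<lambda>a. blinfun_apply a x) - blinfun_apply z x\<bar> < \<delta>"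
                using near by auto
              ultimately show ?thesis using opt env_tau z(2) by linarith
            qed
            finally have D: "expect m D \<le> q * q" using \<delta>(3) by simp
            \<comment> \<open>Markov's inequality: outside \<open>T'\<close> a point of
              \<open>T\<close> has \<open>D > q\<close>, while the mean of \<open>D\<close> is at
              most \<open>q * q\<close>.\<close>
            have "expect m (indicator (- T')) \<le> expect m (\<lambda>a. indicator (- T) a + (1 / q) * D a)"
            proof (rule expect_mono[OF m])
              fix a assume a: "a \<in> K"
              have "0 \<le> D a" using Suc.prems(1) a by (auto simp: D_def minorants_def)
              moreover have "q < D a" if "a \<in> T - T'" using that by (auto simp: T'_def D_def)
              ultimately show "indicator (- T') a \<le> indicator (- T) a + (1 / q) * D a"
                using q(1) by (cases "a \<in> T"; cases "a \<in> T'") (auto simp: field_simps T'_def)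
            qed
            also have "\<dots> = expect m (indicator (- T)) + (1 / q) * expect m D"
              by (simp only: expect_add expect_cmult)
            also have "\<dots> \<le> \<eta> + (1 / q) * (q * q)"
              using eta D q(1) by (intro add_mono mult_left_mono) auto
            finally show "expect m (indicator (- T')) \<le> \<eta> + q" using q(1) by simp
          qed
        qed
        moreover have "Lj j \<subseteq> K" using Lj_props(3) L(3) by blast
        ultimately have "convex_iter e' (Lj j) d \<subseteq> {y. blinfun_apply y x \<le> \<tau> (Suc j) - k}"
          using Lj_props(1,2) T(2) \<eta> q \<delta>(1)
          by (intro IH[of cost M2 T' "Lj j" \<delta> "\<eta> + q"] lsc_cost cost_bound T' q'
              szlenk_iter_thin_slice[OF Suc.prems(1) q(3), folded T'_def])
            (auto simp: T'_def)
        moreover have "y \<in> convex_iter e' (Lj j) d" using Suc.prems(2) by (simp add: Lj_def)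
        ultimately show ?case by auto
      qed
      \<comment> \<open>After this many blocks \<open>\<tau> j\<close> has reached its
        floor.\<close>
      obtain j :: nat where j: "(r * (R * norm x0) - r * c) / \<delta> \<le> real j"
        using real_arch_simple by blast
      then have "\<tau> j = M + r * c"
        using \<delta>(1) by (simp add: \<tau>_def field_simps)
      moreover have "y1 \<in> Lj j"
        using Lj[of j] y1 convex_iter_antimono[OF L(1,2)] by (metis less_imp_le subsetD)
      \<comment> \<open>The tilt itself, lowered by the bounds on \<open>F\<close> and on the rank
        term, is a minorant; \<open>main\<close> for it contradicts the choice of
        \<open>r\<close>.\<close>
      moreover have "(r *\<^sub>R x0, - M - s' * real N) \<in> minorants K cost"
        unfolding minorants_def cost_def G_def
      proof safe
        fix a assume "a \<in> K"
        then show "blinfun_apply a (r *\<^sub>R x0) + (- M - s' * real N)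
            \<le> F a + r * blinfun_apply a x0 - s' * real (rank a)"
          using F(2)[of a] rank(2)[of a] by (simp add: blinfun.scaleR_right abs_le_iff)
      qed
      ultimately have "r * blinfun_apply y1 x0 + (- M - s' * real N) \<le> M + r * c"
        using main[of "r *\<^sub>R x0" "- M - s' * real N" y1 j] by (simp add: blinfun.scaleR_right)
      then show False using r(2) by (simp add: algebra_simps)
    qed
  qed
qed

text \<open>Zero cost and carrier \<open>K\<close> make \<open>carried\<close> trivial. The slice
  for the functional 0 at level \<open>- 1\<close> is everything, and no point satisfies the
  resulting inequality.\<close>

lemma convex_iter_empty:
  fixes g :: "('s + nat) ordinal" and K :: "'a :: real_normed_vector dual set"
  assumes g: "indecomposable g" and K: "compactin weak_star K" "convex K"
    and R: "\<And>a. a \<in> K \<Longrightarrow> norm a \<le> R" "0 \<le> R"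
    and e: "0 < e" "e < e'" and empty: "szlenk_iter e K g = {}"
  shows "convex_iter e' K g = {}"
proof -
  have closed: "closedin weak_star K"
    by (rule compactin_imp_closedin[OF Hausdorff_space_weak_star K(1)])
  have "convex_iter e' K g \<subseteq> {y. blinfun_apply y 0 \<le> - 1}"
  proof (rule convex_iter_slice[OF g R e(1), where F="\<lambda>_. 0" and M=0 and T=K and s=1 and \<eta>=0])
    show "lsc_on K (\<lambda>_. 0)"
      unfolding lsc_on_def
    proof (intro allI)
      fix x :: 'a and c
      have "{z \<in> K. 0 + blinfun_apply z x \<le> c} = K \<inter> {z. blinfun_apply z x \<le> c}" by auto
      then show "closedin weak_star {z \<in> K. 0 + blinfun_apply z x \<le> c}"
        using closedin_Int[OF closed closedin_weak_star_le] by simp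
    qed
    show "carried K (\<lambda>_. 0) K 1 0 y" for y
      unfolding carried_def
    proof (intro exI[of _ "{}"] exI[of _ 1] conjI ballI impI)
      fix m assume m: "m \<in> prob_on K"
      show "expect m (indicator (- K)) \<le> 0"
        using expect_mono[OF m, of "indicator (- K)" "\<lambda>_. 0"] by (simp add: expect_const[OF m])
    qed simp_all
  qed (use K closed empty e in auto)
  then show ?thesis by simp
qed

subsection \<open>Weak-star compactness\<close>

text \<open>The uniform boundedness principle: evaluations are bounded on \<open>K\<close>, so the
  closed sets \<open>E n\<close> cover the space, and by Baire's theorem one of them contains a
  ball.\<close>

lemma weak_star_compact_imp_bounded:
  fixes K :: "'a :: banach dual set"
  assumes K: "compactin weak_star K"
  obtains R where "0 \<le> R" "\<And>a. a \<in> K \<Longrightarrow> norm a \<le> R"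
proof -
  define E where "E n = {x. \<forall>a\<in>K. \<bar>blinfun_apply a x\<bar> \<le> real n}" for n
  have "closed (E n)" for n
  proof -
    have "E n = (\<Inter>a\<in>K. {x. \<bar>blinfun_apply a x\<bar> \<le> real n})" by (auto simp: E_def)
    moreover have "closed {x. \<bar>blinfun_apply a x\<bar> \<le> real n}" for a
      by (intro closed_Collect_le continuous_intros)
    ultimately show ?thesis by auto
  qed
  have "\<exists>n. x \<in> E n" for x
  proof -
    have "compactin euclidean ((\<lambda>a. blinfun_apply a x) ` K)"
      by (rule image_compactin[OF K strong_operator_topology_continuous_evaluation])
    then have "bounded ((\<lambda>a. blinfun_apply a x) ` K)"
      by (simp add: compact_imp_bounded)
    then obtain B where B: "\<And>a. a \<in> K \<Longrightarrow> \<bar>blinfun_apply a x\<bar> \<le> B"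
      by (auto simp: bounded_iff)
    obtain n :: nat where "B \<le> real n" using real_arch_simple by blast
    with B have "x \<in> E n" by (force simp: E_def)
    then show ?thesis ..
  qed
  then have UN: "(\<Union>n. E n) = UNIV" by blast
  have "\<exists>n. interior (E n) \<noteq> {}"
  proof (rule ccontr)
    assume "\<not> ?thesis"
    then have "euclidean interior_of \<Union>(range E) = {}"
      using \<open>\<And>n. closed (E n)\<close>
      by (intro Baire_category_alt) (auto simp: completely_metrizable_space_euclidean)
    then show False using UN by simp
  qed
  then obtain n x0 where "x0 \<in> interior (E n)" by blast
  then obtain r where r: "0 < r" "cball x0 r \<subseteq> E n"
    by (meson interior_subset open_contains_cball open_interior order_trans)
  have "norm a \<le> 2 * real n / r" if a: "a \<in> K" for a
  proof (rule norm_blinfun_bound)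
    show "0 \<le> 2 * real n / r" using r by simp
    fix x
    show "norm (blinfun_apply a x) \<le> 2 * real n / r * norm x"
    proof (cases "x = 0")
      case False
      define t where "t = r / norm x"
      have t: "0 < t" using False r by (simp add: t_def)
      have "x0 + t *\<^sub>R x \<in> cball x0 r" "x0 \<in> cball x0 r"
        using r False by (auto simp: t_def dist_norm)
      then have "\<bar>blinfun_apply a (x0 + t *\<^sub>R x)\<bar> \<le> real n" "\<bar>blinfun_apply a x0\<bar> \<le> real n"
        using r(2) a unfolding E_def by blast+
      then have "\<bar>t * blinfun_apply a x\<bar> \<le> 2 * real n"
        by (simp add: blinfun.add_right blinfun.scaleR_right)
      then have "t * \<bar>blinfun_apply a x\<bar> \<le> 2 * real n" using t by (simp add: abs_mult)
      then show ?thesis using False r by (simp add: t_def field_simps)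
    qed simp
  qed
  then show ?thesis using that[of "2 * real n / r"] r by simp
qed

text \<open>Banach-Alaoglu via Tychonoff: the linear functions form a closed subset of a product of
  intervals, and \<open>Blinfun\<close> maps the result continuously onto the ball.\<close>

lemma compactin_weak_star_cball:
  "compactin weak_star (cball 0 1 :: 'a :: real_normed_vector dual set)"
proof -
  define P where "P = (\<Pi>\<^sub>E x\<in>(UNIV :: 'a set). cball (0 :: real) (norm x))"
  define S where "S = P \<inter> {f. (\<forall>x y. f (x + y) = f x + f y) \<and> (\<forall>c x. f (c *\<^sub>R x) = c * f x)}"
  have "compactin (product_topology (\<lambda>_. euclidean) UNIV) P"
    unfolding P_def compactin_PiE by simp
  then have "compact P" by (simp add: euclidean_product_topology)
  have coord: "continuous_on UNIV (\<lambda>f :: 'a \<Rightarrow> real. f x)" for x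
    by (rule continuous_on_product_coordinates)
  have "closed {f :: 'a \<Rightarrow> real. (\<forall>x y. f (x + y) = f x + f y) \<and> (\<forall>c x. f (c *\<^sub>R x) = c * f x)}"
    by (intro closed_Collect_conj closed_Collect_all closed_Collect_eq continuous_intros coord)
  with \<open>compact P\<close> have "compact S" unfolding S_def by (rule compact_Int_closed)
  have S: "bounded_linear f" "\<And>x. \<bar>f x\<bar> \<le> norm x" if "f \<in> S" for f
  proof -
    show b: "\<bar>f x\<bar> \<le> norm x" for x using that by (auto simp: S_def P_def)
    show "bounded_linear f"
      by (rule bounded_linear_intro[where K=1]) (use that b in \<open>auto simp: S_def\<close>)
  qed
  have "continuous_map (subtopology euclidean S) weak_star Blinfun"
    unfolding continuous_on_strong_operator_topo_iff_coordinatewise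
  proof
    fix x
    have "continuous_map (subtopology euclidean S) euclidean (\<lambda>f. f x)"
      using coord continuous_on_subset by (metis continuous_map_iff_continuous subset_UNIV)
    then show "continuous_map (subtopology euclidean S) euclidean (\<lambda>f. blinfun_apply (Blinfun f) x)"
      by (rule continuous_map_eq) (simp add: bounded_linear_Blinfun_apply S)
  qed
  then have "compactin weak_star (Blinfun ` S)"
    by (rule image_compactin[rotated]) (simp add: compactin_subtopology \<open>compact S\<close>)
  moreover have "Blinfun ` S = cball 0 1"
  proof (intro equalityI subsetI)
    fix z assume "z \<in> Blinfun ` S"
    then obtain f where f: "f \<in> S" "z = Blinfun f" by blast
    then have "norm z \<le> 1"
      using S[OF f(1)] by (intro norm_blinfun_bound) (simp_all add: bounded_linear_Blinfun_apply)
    then show "z \<in> cball 0 1" by simp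
  next
    fix z :: "'a dual" assume z: "z \<in> cball 0 1"
    have "\<bar>blinfun_apply z x\<bar> \<le> norm x" for x
      using norm_blinfun[of z x] z mult_right_mono[of "norm z" 1 "norm x"] by simp
    then have "blinfun_apply z \<in> S"
      by (auto simp: S_def P_def blinfun.add_right blinfun.scaleR_right)
    then show "z \<in> Blinfun ` S"
      by (metis blinfun_apply_inverse image_eqI)
  qed
  ultimately show ?thesis by simp
qed

subsection \<open>Indices\<close>

text \<open>\<open>h\<close> halves distances, so balls of diameter \<open>d\<close> covering part
  of \<open>B\<close> pull back to balls of diameter \<open>2 * d\<close>.\<close>

lemma midpoint_sigma_deriv:
  fixes x :: "'a :: real_normed_vector dual"
  defines "h \<equiv> \<lambda>z. (1 / 2) *\<^sub>R (x + z)"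
  assumes sub: "h ` A \<subseteq> B"
  shows "h ` sigma_deriv e A \<subseteq> sigma_deriv (e / 2) B"
proof safe
  fix z assume z: "z \<in> sigma_deriv e A"
  have cont: "continuous_map weak_star weak_star h"
    unfolding continuous_on_strong_operator_topo_iff_coordinatewise
  proof
    fix y
    have "continuous_map weak_star euclidean (\<lambda>z. (1 / 2) * (blinfun_apply x y + blinfun_apply z y))"
      by (intro continuous_map_real_mult continuous_map_add strong_operator_topology_continuous_evaluation) simp_all
    then show "continuous_map weak_star euclidean (\<lambda>z. blinfun_apply (h z) y)"
      by (simp add: h_def blinfun.scaleR_left blinfun.add_left)
  qed
  have "ereal (e / 2) \<le> kuratowski (B \<inter> U)" if U: "openin weak_star U" "h z \<in> U" for U
  proof (rule ccontr)
    assume "\<not> ereal (e / 2) \<le> kuratowski (B \<inter> U)"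
    then obtain d C where d: "0 < d" "d < e / 2" "finite C" "B \<inter> U \<subseteq> (\<Union>c\<in>C. cball c (d / 2))"
      unfolding not_le kuratowski_less_iff by blast
    have "A \<inter> h -` U \<subseteq> (\<Union>c\<in>(\<lambda>c. 2 *\<^sub>R c - x) ` C. cball c (2 * d / 2))"
    proof
      fix a assume "a \<in> A \<inter> h -` U"
      then have "h a \<in> B \<inter> U" using sub by auto
      then obtain c where c: "c \<in> C" "norm (c - h a) \<le> d / 2" using d(4) by (auto simp: dist_norm)
      have "(2 *\<^sub>R c - x) - a = 2 *\<^sub>R (c - h a)"
        by (simp add: h_def algebra_simps)
      then have "norm ((2 *\<^sub>R c - x) - a) \<le> d" using c(2) by simp
      then show "a \<in> (\<Union>c\<in>(\<lambda>c. 2 *\<^sub>R c - x) ` C. cball c (2 * d / 2))"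
        using c(1) by (auto simp: dist_norm)
    qed
    then have "kuratowski (A \<inter> h -` U) < ereal e"
      unfolding kuratowski_less_iff using d
      by (intro exI[of _ "2 * d"] exI[of _ "(\<lambda>c. 2 *\<^sub>R c - x) ` C"]) auto
    moreover have "openin weak_star (h -` U)"
      using openin_continuous_map_preimage[OF cont U(1)] by (simp add: strong_operator_topology_topspace vimage_def)
    ultimately show False using z U(2) by (force simp: sigma_deriv_iff not_le[symmetric])
  qed
  then show "h z \<in> sigma_deriv (e / 2) B"
    using z sub by (auto simp: sigma_deriv_iff)
qed

lemma midpoint_szlenk_iter:
  fixes x :: "'a :: real_normed_vector dual" and a :: "('s + nat) ordinal"
  assumes "(\<lambda>z. (1 / 2) *\<^sub>R (x + z)) ` A \<subseteq> B"
  shows "(\<lambda>z. (1 / 2) *\<^sub>R (x + z)) ` szlenk_iter e A a \<subseteq> szlenk_iter (e / 2) B a"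
proof (induction a rule: ordinal_induct)
  case zero
  show ?case using assms by (simp add: trans_iter_zero)
next
  case (succ a)
  then show ?case unfolding trans_iter_succ[OF inf_sum] by (rule midpoint_sigma_deriv)
next
  case (limit a)
  then show ?case by (fastforce simp: trans_iter_limit)
qed

text \<open>If \<open>z\<close> survives \<open>a\<close> derivations, a half-size copy of all of
  \<open>K\<close> survives \<open>a\<close> derivations at half the scale; inside it, the copy of a
  survivor lasts another \<open>a\<close>.\<close>

lemma szlenk_iter_double:
  fixes a :: "('s + nat) ordinal"
  assumes K: "convex K" and ne: "szlenk_iter e K a \<noteq> {}"
  shows "szlenk_iter (e / 2) K (a + a) \<noteq> {}"
proof -
  obtain z where z: "z \<in> szlenk_iter e K a" using ne by blast
  have mid: "(\<lambda>z. (1 / 2) *\<^sub>R (x + z)) ` K \<subseteq> K" if "x \<in> K" for x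
    using that convexD[OF K, of x _ "1 / 2" "1 / 2"] by (auto simp: scaleR_add_right)
  have "(\<lambda>x. (1 / 2) *\<^sub>R (z + x)) ` K \<subseteq> szlenk_iter (e / 2) K a"
  proof
    fix w assume "w \<in> (\<lambda>x. (1 / 2) *\<^sub>R (z + x)) ` K"
    then obtain x where "x \<in> K" "w = (1 / 2) *\<^sub>R (x + z)" by (auto simp: add.commute)
    then show "w \<in> szlenk_iter (e / 2) K a"
      using midpoint_szlenk_iter[OF mid, of x e a] z by auto
  qed
  then have "(\<lambda>x. (1 / 2) *\<^sub>R (z + x)) ` szlenk_iter e K a \<subseteq> szlenk_iter (e / 2) (szlenk_iter (e / 2) K a) a"
    by (rule midpoint_szlenk_iter)
  also have "\<dots> = szlenk_iter (e / 2) K (a + a)"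
    by (rule trans_iter_plus[symmetric, OF sigma_deriv_subset])
  finally show ?thesis using z by blast
qed

section \<open>Comparison of the two indices\<close>

lemma Inf_Ord_le_iff:
  fixes P :: "'o :: wellorder \<Rightarrow> bool"
  assumes "\<And>a b. P a \<Longrightarrow> a \<le> b \<Longrightarrow> P b"
  shows "Inf {Ord a | a. P a} \<le> Ord g \<longleftrightarrow> P g"
proof
  assume le: "Inf {Ord a | a. P a} \<le> Ord g"
  then have ex: "\<exists>a. P a" by (auto simp: Inf_with_infty_def split: if_splits)
  then have "(LEAST a. P a) \<le> g" using le by (simp add: Inf_with_infty_def)
  with LeastI_ex[OF ex] assms show "P g" by blast
next
  assume "P g"
  then show "Inf {Ord a | a. P a} \<le> Ord g" by (intro Inf_lower) auto
qed

lemma Sz_eps_le_iff: "Sz_eps K e \<le> Ord g \<longleftrightarrow> szlenk_iter e K g = {}"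
  unfolding Sz_eps_def by (rule Inf_Ord_le_iff) (use szlenk_iter_antimono in blast)

lemma Cz_eps_le_iff:
  assumes "closedin weak_star K" "convex K"
  shows "Cz_eps K e \<le> Ord g \<longleftrightarrow> convex_iter e K g = {}"
  unfolding Cz_eps_def by (rule Inf_Ord_le_iff) (use convex_iter_antimono[OF assms] in blast)

lemma Sz_le_Cz: "Sz K \<le> Cz K"
proof -
  have "szlenk_iter e K a \<subseteq> convex_iter e K a" for e and a :: "'a index_ordinal"
    by (rule trans_iter_mono) (meson order_refl order_trans sigma_deriv_mono sigma_deriv_subset_convex)+
  then have "Sz_eps K e \<le> Cz_eps K e" for e
    unfolding Sz_eps_def Cz_eps_def by (intro Inf_superset_mono) blast
  then show ?thesis unfolding Sz_def Cz_def by (intro SUP_mono) blast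
qed

lemma Sz_indecomposable:
  assumes K: "convex K" "K \<noteq> {}" and g: "Sz K = Ord g"
  shows "indecomposable g"
  unfolding indecomposable_def
proof (intro conjI allI impI)
  have le: "Sz_eps K e \<le> Ord g" if "0 < e" for e
    using that unfolding g[symmetric] Sz_def by (intro SUP_upper) simp
  then have "szlenk_iter 1 K g = {}" using Sz_eps_le_iff[of K 1 g] by simp
  then have "g \<noteq> 0" using K(2) by (auto simp: trans_iter_zero)
  then show "0 < g" using zero_ordinal_least[of g] by (simp add: le_less)
  fix a assume "a < g"
  then have "\<not> Sz K \<le> Ord a" by (simp add: g)
  then obtain e where e: "0 < e" "\<not> Sz_eps K e \<le> Ord a"
    unfolding Sz_def SUP_le_iff by auto
  then have "szlenk_iter (e / 2) K (a + a) \<noteq> {}"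
    unfolding Sz_eps_le_iff by (intro szlenk_iter_double K(1))
  then have "\<not> Sz_eps K (e / 2) \<le> Ord (a + a)" by (simp add: Sz_eps_le_iff)
  then show "a + a < g"
    using le[of "e / 2"] e(1) order_trans[of "Sz_eps K (e / 2)" "Ord g" "Ord (a + a)"]
    by (metis half_gt_zero less_eq_with_infty.simps(3) not_le)
qed

theorem Cz_eq_Sz:
  fixes K :: "'a :: banach dual set"
  assumes K: "compactin weak_star K" "convex K"
  shows "Cz K = Sz K"
proof (rule antisym[OF _ Sz_le_Cz])
  have closed: "closedin weak_star K"
    by (rule compactin_imp_closedin[OF Hausdorff_space_weak_star K(1)])
  obtain R where R: "0 \<le> R" "\<And>a. a \<in> K \<Longrightarrow> norm a \<le> R"
    using weak_star_compact_imp_bounded[OF K(1)] by blast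
  have "Cz_eps K e \<le> Sz K" if "0 < e" for e
  proof (cases "Sz K")
    case Infty
    then show ?thesis by simp
  next
    case (Ord g)
    have "convex_iter e K g = {}"
    \<comment> \<open>The empty set has index 0, which is not indecomposable, so it is treated
      separately.\<close>
    proof (cases "K = {}")
      case True
      then show ?thesis using convex_iter_subset[OF closed K(2), of e g] by simp
    next
      case False
      \<comment> \<open>Halving the scale leaves the strict gap that
        \<open>convex_iter_empty\<close> requires; the supremum over all scales absorbs it.\<close>
      have "Sz_eps K (e / 2) \<le> Ord g"
        using that unfolding Ord[symmetric] Sz_def by (intro SUP_upper) simp
      then have "szlenk_iter (e / 2) K g = {}" by (simp only: Sz_eps_le_iff)
      with that show ?thesis
        by (intro convex_iter_empty[where e="e / 2", OF Sz_indecomposable[OF K(2) False Ord] K R(2,1)]) simp_all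
    qed
    then show ?thesis using Cz_eps_le_iff[OF closed K(2)] Ord by simp
  qed
  then show "Cz K \<le> Sz K" unfolding Cz_def by (intro SUP_least) simp
qed

theorem corollary5p11:
  assumes separable: "separable_space (euclidean :: 'a :: banach topology)"
  shows "(\<forall>K :: 'a dual set. compactin weak_star K \<and> convex K \<and>
            (\<exists>n :: nat. Sz K \<le> Ord (omega ^ (n + 1))) \<longrightarrow> Cz K = Sz K)
       \<and> convex_Szlenk_index TYPE('a) = Szlenk_index TYPE('a)"
  by (simp add: Cz_eq_Sz convex_Szlenk_index_def Szlenk_index_def compactin_weak_star_cball)

end
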